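(* Let $n\ge 4$ and $r\ge 0$ be integers, and let $C_n^c$ be the complement of the cyclic graph on $[n]$. Then the ideal $\mathrm{Inc}(\mathbb{N})_{n,n+r}(I(C_n^c))\subseteq R_{n+r}$ is Cohen--Macaulay.
   Context: Let $k$ be a field, $R_m=k[x_1,\dots,x_m]$ and $[m]=\{1,\dots,m\}$. For $n\le m$, $\mathrm{Inc}(\mathbb{N})_{n,m}$ is the set of strictly increasing functions $\pi:[n]\to[m]$; each such $\pi$ induces the $k$-algebra homomorphism $\pi:R_n\to R_m$, $x_i\mapsto x_{\pi(i)}$. For an ideal $I\subseteq R_n$, $\mathrm{Inc}(\mathbb{N})_{n,m}(I):=\sum_{\pi\in\mathrm{Inc}(\mathbb{N})_{n,m}}\pi(I)R_m$, the ideal of $R_m$ generated by the images of $I$ under all such $\pi$. The edge ideal of a simple graph $G$ on $[n]$ is $I(G)=(x_ix_j : \{i,j\}\in E(G))\subseteq R_n$. For $n\ge 4$, $C_n^c$ is the complement of the cycle on $[n]$ with edges $\{i,i+1\}$ ($1\le i\le n-1$) and $\{1,n\}$; i.e. for $1\le i<j\le n$, $\{i,j\}$ is an edge of $C_n^c$ exactly when $2\le j-i\le n-2$. An ideal $I\subseteq R_m$ is called Cohen--Macaulay if the (graded) quotient ring $R_m/I$ is Cohen--Macaulay, i.e. $\operatorname{depth}(R_m/I)=\dim(R_m/I)$. *)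

theory Defs
  imports "HOL-Algebra.Algebra" "HOL-Library.Poly_Mapping" "HOL-Library.Extended_Nat"
begin

section \<open>Polynomial rings\<close>

text \<open>
  A monomial is an exponent vector of type \<open>nat \<Rightarrow>\<^sub>0 nat\<close>, a polynomial is a finitely supported
  family of coefficients indexed by monomials. The type contains the polynomials in all variables
  \<open>x\<^sub>i\<close>, \<open>i\<close> a natural number; \<open>mpoly_ring m\<close> below is the subring \<open>k[x\<^sub>1, \<dots>, x\<^sub>m]\<close>.
\<close>

type_synonym 'k mpoly = "(nat \<Rightarrow>\<^sub>0 nat) \<Rightarrow>\<^sub>0 'k"

definition Const :: "'k \<Rightarrow> 'k::comm_ring_1 mpoly"
  where "Const c = Poly_Mapping.single 0 c"

definition Var :: "nat \<Rightarrow> 'k::comm_ring_1 mpoly"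
  where "Var i = Poly_Mapping.single (Poly_Mapping.single i 1) 1"

definition mpoly_ring :: "nat \<Rightarrow> 'k::comm_ring_1 mpoly ring"
  where "mpoly_ring m = \<lparr>carrier = {p. \<forall>t\<in>Poly_Mapping.keys p. Poly_Mapping.keys t \<subseteq> {1..m}},
                monoid.mult = (*), one = 1, ring.zero = 0, ring.add = (+)\<rparr>"

text \<open>The \<open>k\<close>-algebra homomorphism \<open>x\<^sub>i \<mapsto> x\<^bsub>\<pi>(i)\<^esub>\<close>, i.e. evaluation at the points \<open>Var (\<pi> i)\<close>.\<close>

definition subst_vars :: "(nat \<Rightarrow> nat) \<Rightarrow> 'k::comm_ring_1 mpoly \<Rightarrow> 'k mpoly"
  where "subst_vars \<pi> p =
    (\<Sum>t\<in>Poly_Mapping.keys p. Const (Poly_Mapping.lookup p t) *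
        (\<Prod>i\<in>Poly_Mapping.keys t. Var (\<pi> i) ^ Poly_Mapping.lookup t i))"


section \<open>Increasing maps and the induced ideals\<close>

definition Inc :: "nat \<Rightarrow> nat \<Rightarrow> (nat \<Rightarrow> nat) set"
  where "Inc n m = {\<pi> \<in> {1..n} \<rightarrow>\<^sub>E {1..m}. strict_mono_on {1..n} \<pi>}"

definition Inc_ideal :: "nat \<Rightarrow> nat \<Rightarrow> 'k::comm_ring_1 mpoly set \<Rightarrow> 'k mpoly set"
  where "Inc_ideal n m I = Idl\<^bsub>mpoly_ring m\<^esub> (\<Union>\<pi>\<in>Inc n m. subst_vars \<pi> ` I)"


section \<open>Graphs and edge ideals\<close>

text \<open>A simple graph on \<open>{1..n}\<close> is given by its edge set, a set of two-element subsets of \<open>{1..n}\<close>.\<close>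

definition cycle_edges :: "nat \<Rightarrow> nat set set"
  where "cycle_edges n = {{i, i + 1} | i. 1 \<le> i \<and> i \<le> n - 1} \<union> {{1, n}}"

definition complement_edges :: "nat \<Rightarrow> nat set set \<Rightarrow> nat set set"
  where "complement_edges n E = {e. e \<subseteq> {1..n} \<and> card e = 2 \<and> e \<notin> E}"

definition edge_ideal :: "nat \<Rightarrow> nat set set \<Rightarrow> 'k::comm_ring_1 mpoly set"
  where "edge_ideal n E = Idl\<^bsub>mpoly_ring n\<^esub> {Var i * Var j | i j. {i, j} \<in> E}"


section \<open>Dimension, depth and the Cohen--Macaulay property\<close>

text \<open>The zero ring gets dimension \<open>0\<close> here, as the supremum of the empty set.\<close>

definition krull_dim :: "('a, 'b) ring_scheme \<Rightarrow> enat"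
  where "krull_dim A = Sup {enat l | l.
    \<exists>P :: nat \<Rightarrow> 'a set. (\<forall>i\<le>l. primeideal (P i) A) \<and> (\<forall>i<l. P i \<subset> P (Suc i))}"

text \<open>
  \<open>xs ! i\<close> is a nonzerodivisor modulo \<open>(xs ! 0, \<dots>, xs ! (i - 1))\<close>, and the whole sequence generates
  a proper ideal.
\<close>

definition regular_sequence :: "('a, 'b) ring_scheme \<Rightarrow> 'a list \<Rightarrow> bool"
  where "regular_sequence A xs \<longleftrightarrow>
    set xs \<subseteq> carrier A \<and>
    (\<forall>i<length xs. \<forall>a\<in>carrier A.
        xs ! i \<otimes>\<^bsub>A\<^esub> a \<in> Idl\<^bsub>A\<^esub> (set (take i xs)) \<longrightarrow> a \<in> Idl\<^bsub>A\<^esub> (set (take i xs))) \<and>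
    Idl\<^bsub>A\<^esub> (set xs) \<noteq> carrier A"

definition depth :: "('a, 'b) ring_scheme \<Rightarrow> 'a set \<Rightarrow> enat"
  where "depth A J = Sup {enat (length xs) | xs. regular_sequence A xs \<and> set xs \<subseteq> J}"

definition irrelevant_ideal :: "nat \<Rightarrow> 'k::comm_ring_1 mpoly set"
  where "irrelevant_ideal m = Idl\<^bsub>mpoly_ring m\<^esub> (Var ` {1..m})"

text \<open>
  The depth of the graded ring \<open>mpoly_ring m / I\<close> is taken with respect to its homogeneous maximal ideal,
  the image of \<open>(x\<^sub>1, \<dots>, x\<^sub>m)\<close>.
\<close>

definition cohen_macaulay :: "nat \<Rightarrow> 'k::comm_ring_1 mpoly set \<Rightarrow> bool"
  where "cohen_macaulay m I \<longleftrightarrow>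
    depth (mpoly_ring m Quot I) ((\<lambda>p. I +>\<^bsub>mpoly_ring m\<^esub> p) ` irrelevant_ideal m) = krull_dim (mpoly_ring m Quot I)"


section \<open>Basic facts\<close>

lemma mpoly_ring_simps [simp]:
  "monoid.mult (mpoly_ring m) = (*)" "one (mpoly_ring m) = 1" "ring.zero (mpoly_ring m) = 0" "ring.add (mpoly_ring m) = (+)"
  by (simp_all add: mpoly_ring_def)

lemma carrier_mpoly_ring_iff:
  "p \<in> carrier (mpoly_ring m) \<longleftrightarrow> (\<forall>t\<in>Poly_Mapping.keys p. Poly_Mapping.keys t \<subseteq> {1..m})"
  by (simp add: mpoly_ring_def)

lemma mpoly_ring_closed:
  fixes p q :: "'k::comm_ring_1 mpoly"
  shows "0 \<in> carrier (mpoly_ring m :: 'k mpoly ring)" "1 \<in> carrier (mpoly_ring m :: 'k mpoly ring)"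
    and "Const c \<in> carrier (mpoly_ring m)"
    and "i \<in> {1..m} \<Longrightarrow> Var i \<in> carrier (mpoly_ring m :: 'k mpoly ring)"
    and "p \<in> carrier (mpoly_ring m) \<Longrightarrow> - p \<in> carrier (mpoly_ring m)"
    and "p \<in> carrier (mpoly_ring m) \<Longrightarrow> q \<in> carrier (mpoly_ring m) \<Longrightarrow> p + q \<in> carrier (mpoly_ring m)"
    and "p \<in> carrier (mpoly_ring m) \<Longrightarrow> q \<in> carrier (mpoly_ring m) \<Longrightarrow> p * q \<in> carrier (mpoly_ring m)"
proof -
  assume p: "p \<in> carrier (mpoly_ring m)" and q: "q \<in> carrier (mpoly_ring m)"
  show "p + q \<in> carrier (mpoly_ring m)"
    using p q Poly_Mapping.keys_add[of p q] unfolding carrier_mpoly_ring_iff by blast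
  show "p * q \<in> carrier (mpoly_ring m)"
    unfolding carrier_mpoly_ring_iff
  proof
    fix t assume "t \<in> Poly_Mapping.keys (p * q)"
    then obtain a b where "t = a + b" "a \<in> Poly_Mapping.keys p" "b \<in> Poly_Mapping.keys q"
      using keys_mult[of p q] by blast
    then show "Poly_Mapping.keys t \<subseteq> {1..m}"
      using p q Poly_Mapping.keys_add[of a b] unfolding carrier_mpoly_ring_iff by blast
  qed
qed (auto simp: carrier_mpoly_ring_iff Const_def Var_def in_keys_iff lookup_single when_def
       lookup_one split: if_splits)

lemma cring_mpoly_ring: "cring (mpoly_ring m :: 'k::comm_ring_1 mpoly ring)"
proof (rule cringI)
  show "abelian_group (mpoly_ring m :: 'k mpoly ring)"
  proof (rule abelian_groupI)
    fix x :: "'k mpoly" assume "x \<in> carrier (mpoly_ring m)"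
    then show "\<exists>y\<in>carrier (mpoly_ring m). y \<oplus>\<^bsub>mpoly_ring m\<^esub> x = \<zero>\<^bsub>mpoly_ring m\<^esub>"
      by (intro bexI[of _ "- x"]) (auto simp: mpoly_ring_closed)
  qed (auto simp: mpoly_ring_closed algebra_simps)
  show "comm_monoid (mpoly_ring m :: 'k mpoly ring)"
    by (rule comm_monoidI) (auto simp: mpoly_ring_closed algebra_simps)
qed (auto simp: algebra_simps)

lemma complement_cycle_edges_iff:
  assumes "n \<ge> 4" "1 \<le> i" "i < j" "j \<le> n"
  shows "{i, j} \<in> complement_edges n (cycle_edges n) \<longleftrightarrow> 2 \<le> j - i \<and> j - i \<le> n - 2"
proof -
  have "{i, j} \<in> cycle_edges n \<longleftrightarrow> j = i + 1 \<or> (i = 1 \<and> j = n)"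
    using assms unfolding cycle_edges_def by (auto simp: doubleton_eq_iff)
  then show ?thesis
    using assms unfolding complement_edges_def by auto
qed

lemma subst_vars_Const: "subst_vars \<pi> (Const c) = Const (c::'k::comm_ring_1)"
  by (cases "c = 0") (auto simp: subst_vars_def Const_def)

lemma subst_vars_Var: "subst_vars \<pi> (Var i) = (Var (\<pi> i) :: 'k::comm_ring_1 mpoly)"
  by (simp add: subst_vars_def Var_def Const_def)

lemma subst_vars_add:
  "subst_vars \<pi> (p + q) = subst_vars \<pi> p + (subst_vars \<pi> q :: 'k::comm_ring_1 mpoly)"
  unfolding subst_vars_def
  by (rule setsum_keys_plus_distrib) (simp_all add: Const_def single_add algebra_simps)

lemma subst_vars_single:
  "subst_vars \<pi> (Poly_Mapping.single t c) =
    (Const c :: 'k::comm_ring_1 mpoly) *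
      (\<Prod>i\<in>Poly_Mapping.keys t. Var (\<pi> i) ^ Poly_Mapping.lookup t i)"
  by (cases "c = 0") (auto simp: subst_vars_def Const_def)

lemma subst_vars_monom_add:
  "(\<Prod>i\<in>Poly_Mapping.keys (s + t). (Var (\<pi> i) :: 'k::comm_ring_1 mpoly) ^ Poly_Mapping.lookup (s + t) i) =
   (\<Prod>i\<in>Poly_Mapping.keys s. Var (\<pi> i) ^ Poly_Mapping.lookup s i) *
   (\<Prod>i\<in>Poly_Mapping.keys t. Var (\<pi> i) ^ Poly_Mapping.lookup t i)"
proof -
  let ?K = "Poly_Mapping.keys s \<union> Poly_Mapping.keys t"
  have *: "(\<Prod>i\<in>Poly_Mapping.keys u. (Var (\<pi> i) :: 'k mpoly) ^ Poly_Mapping.lookup u i) =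
        (\<Prod>i\<in>?K. Var (\<pi> i) ^ Poly_Mapping.lookup u i)" if "Poly_Mapping.keys u \<subseteq> ?K" for u
    using that by (intro prod.mono_neutral_left) (auto simp: in_keys_iff)
  show ?thesis
    using Poly_Mapping.keys_add[of s t]
    by (subst (1 2 3) *) (auto simp: lookup_add power_add prod.distrib)
qed

lemma poly_mapping_sum_singles:
  "p = (\<Sum>t\<in>Poly_Mapping.keys p. Poly_Mapping.single t (Poly_Mapping.lookup p t))"
  by (rule poly_mapping_eqI)
     (auto simp: lookup_sum lookup_single when_def in_keys_iff sum.delta'[OF finite_keys])

lemma subst_vars_sum:
  "finite A \<Longrightarrow> subst_vars \<pi> (sum f A) = (\<Sum>a\<in>A. subst_vars \<pi> (f a) :: 'k::comm_ring_1 mpoly)"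
  by (induction A rule: finite_induct) (auto simp: subst_vars_add, simp add: subst_vars_def)

lemma subst_vars_mult:
  "subst_vars \<pi> (p * q) = subst_vars \<pi> p * (subst_vars \<pi> q :: 'k::comm_ring_1 mpoly)"
proof -
  have single: "subst_vars \<pi> (Poly_Mapping.single s a * Poly_Mapping.single t b) =
      subst_vars \<pi> (Poly_Mapping.single s a) * subst_vars \<pi> (Poly_Mapping.single t (b::'k))" for s t a b
    by (simp add: mult_single subst_vars_single subst_vars_monom_add)
       (simp add: Const_def mult_single[of 0 _ 0, simplified, symmetric] mult_ac)
  show ?thesis
    by (subst (1 2) poly_mapping_sum_singles[of p], subst (1 2) poly_mapping_sum_singles[of q])
       (simp add: sum_product subst_vars_sum single)
qed

lemma subst_vars_closed:
  fixes p :: "'k::comm_ring_1 mpoly"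
  assumes "\<pi> ` {1..n} \<subseteq> {1..m}" "p \<in> carrier (mpoly_ring n)"
  shows "subst_vars \<pi> p \<in> carrier (mpoly_ring m)"
proof -
  have pow: "q ^ l \<in> carrier (mpoly_ring m)" if "q \<in> carrier (mpoly_ring m)" for q :: "'k mpoly" and l
    using that by (induction l) (auto simp: mpoly_ring_closed)
  have prod: "prod f A \<in> carrier (mpoly_ring m)" if "\<And>a. a \<in> A \<Longrightarrow> f a \<in> carrier (mpoly_ring m)"
    for f :: "nat \<Rightarrow> 'k mpoly" and A
    using that by (induction A rule: infinite_finite_induct) (auto simp: mpoly_ring_closed)
  have sum: "sum f A \<in> carrier (mpoly_ring m)" if "\<And>a. a \<in> A \<Longrightarrow> f a \<in> carrier (mpoly_ring m)"
    for f :: "(nat \<Rightarrow>\<^sub>0 nat) \<Rightarrow> 'k mpoly" and A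
    using that by (induction A rule: infinite_finite_induct) (auto simp: mpoly_ring_closed)
  have "Var (\<pi> i) \<in> carrier (mpoly_ring m :: 'k mpoly ring)"
    if "t \<in> Poly_Mapping.keys p" "i \<in> Poly_Mapping.keys t" for t i
  proof -
    have "i \<in> {1..n}"
      using assms(2) that unfolding carrier_mpoly_ring_iff by blast
    then show ?thesis
      using assms(1) by (intro mpoly_ring_closed(4)) blast
  qed
  then show ?thesis
    unfolding subst_vars_def
    by (intro sum mpoly_ring_closed(3,7) prod pow)
qed

lemma subst_vars_ring_hom:
  assumes "\<pi> \<in> Inc n m"
  shows "subst_vars \<pi> \<in> ring_hom (mpoly_ring n) (mpoly_ring m :: 'k::comm_ring_1 mpoly ring)"
proof (rule ring_hom_memI)
  fix p :: "'k mpoly" assume "p \<in> carrier (mpoly_ring n)"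
  then show "subst_vars \<pi> p \<in> carrier (mpoly_ring m)"
    using assms by (intro subst_vars_closed[of _ n]) (auto simp: Inc_def PiE_iff)
next
  show "subst_vars \<pi> \<one>\<^bsub>mpoly_ring n\<^esub> = (\<one>\<^bsub>mpoly_ring m\<^esub> :: 'k mpoly)"
    using subst_vars_Const[of \<pi> "1::'k"] by (simp add: Const_def)
qed (simp_all add: subst_vars_add subst_vars_mult)

end

theory Submission
  imports Defs
begin

text \<open>
  Two observations reduce the theorem to graphs. First, spreading the edges of \<open>C\<^sub>n\<^sup>c\<close> along the
  increasing maps \<open>{1..n} \<rightarrow> {1..n + r}\<close> turns a gap \<open>2 \<le> j - i \<le> n - 2\<close> into exactly the gaps
  between \<open>2\<close> and \<open>n + r - 2\<close>: a gap can only grow, by at most \<open>r\<close>, and every growth occurs. So the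
  ideal in question is the edge ideal of the complement of the cycle on \<open>m = n + r\<close> vertices
  (\<open>Inc_ideal_complement_cycle\<close>). Second, that ideal is the Stanley--Reisner ideal of the clique
  complex of the cycle, which is the cycle itself because it has no triangles when \<open>m \<ge> 4\<close>; and a
  connected one-dimensional complex is Cohen--Macaulay over every field. The second part is proved for
  every connected triangle-free graph with at least one edge
  (\<open>cohen_macaulay_nonedge_ideal\<close>).

  For such a graph, a polynomial lies in the ideal exactly if its coefficients vanish at all monomials
  \<open>x\<^sub>i\<^sup>a x\<^sub>j\<^sup>b\<close> with \<open>{i, j}\<close> an edge (\<open>mem_nonedge_ideal_iff\<close>), so everything in the quotient
  can be read off on edges. Depth and dimension are squeezed by \<open>2 \<le> depth \<le> dim \<le> 2\<close>.

  \<^item> The quotient has dimension at most \<open>2\<close>: the monomials above with exponents up to \<open>L\<close> number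
    \<open>O(L\<^sup>2)\<close>, while three elements \<open>x, y, z\<close> have \<open>(N + 1)\<^sup>3\<close> products of powers up to \<open>N\<close>. Hence
    any three elements are algebraically dependent. Choosing \<open>x, y, z\<close> in the successive differences
    of a chain of four primes, the lexicographically lowest coefficient of such a relation would be a
    nonzero constant in the last prime.

  \<^item> Depth never exceeds dimension: below a prime containing a regular sequence there is a
    smaller one that omits its last element (\<open>depth_le_krull_dim\<close>).

  \<^item> The sum of the products \<open>x\<^sub>i x\<^sub>j\<close> over the edges, followed by the sum of all variables, is a
    regular sequence. On one edge these are \<open>xy\<close> and \<open>x + y\<close>, which are coprime; divisibility by
    \<open>xy\<close> on each edge glues to divisibility in the quotient because the graph is connected.

  These two elements are used instead of two linear forms because, over a finite field, no two linear
  forms will do once the chromatic number of the graph exceeds the number of points of the projective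
  line: their restrictions to the edges would be linearly dependent on some edge.
\<close>

section \<open>Depth is at most dimension\<close>

text \<open>
  Krull's argument: an ideal maximal among those that contain \<open>J\<close> and miss \<open>S\<close> is prime, since enlarging
  it by \<open>a\<close> and by \<open>b\<close> produces two elements of \<open>S\<close>, and their product lies in \<open>P + (ab)\<close>.
\<close>

lemma (in cring) exists_primeideal_avoiding:
  assumes J: "ideal J R" and S: "S \<subseteq> carrier R" "S \<noteq> {}"
    and mult: "\<And>x y. x \<in> S \<Longrightarrow> y \<in> S \<Longrightarrow> x \<otimes> y \<in> S"
    and disj: "J \<inter> S = {}"
  shows "\<exists>P. primeideal P R \<and> J \<subseteq> P \<and> P \<inter> S = {}"
proof -
  define F where "F = {K. ideal K R \<and> J \<subseteq> K \<and> K \<inter> S = {}}"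
  have "\<exists>P\<in>F. \<forall>K\<in>F. P \<subseteq> K \<longrightarrow> K = P"
  proof (rule subset_Zorn_nonempty)
    show "F \<noteq> {}" using J disj by (auto simp: F_def)
    fix C assume C: "C \<noteq> {}" "subset.chain F C"
    then have "subset.chain {K. ideal K R} C"
      by (auto simp: F_def subset.chain_def)
    then have "ideal (\<Union>C) R"
      using chain_Union_is_ideal[of C] C(1) by simp
    then show "\<Union>C \<in> F"
      using C unfolding F_def subset.chain_def by blast
  qed
  then obtain P where P: "ideal P R" "J \<subseteq> P" "P \<inter> S = {}"
    and max: "\<And>K. ideal K R \<Longrightarrow> P \<subseteq> K \<Longrightarrow> K \<inter> S = {} \<Longrightarrow> K = P"
    unfolding F_def by auto
  interpret P: ideal P R by fact
  have meets: "\<exists>p\<in>P. \<exists>r\<in>carrier R. p \<oplus> r \<otimes> a \<in> S" if a: "a \<in> carrier R" "a \<notin> P" for a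
  proof -
    let ?K = "P <+>\<^bsub>R\<^esub> PIdl a"
    have sub: "P \<union> PIdl a \<subseteq> carrier R"
      using P.a_subset additive_subgroup.a_subset[OF ideal.axioms(1)[OF cgenideal_ideal[OF a(1)]]] by simp
    have K: "ideal ?K R" "P \<union> PIdl a \<subseteq> ?K"
      using add_ideals[OF P(1) cgenideal_ideal[OF a(1)]] genideal_self[OF sub]
      unfolding union_genideal[OF P(1) cgenideal_ideal[OF a(1)]] by simp_all
    then have "?K \<noteq> P"
      using a(2) cgenideal_self[OF a(1)] by blast
    then have "?K \<inter> S \<noteq> {}"
      using max[OF K(1)] K(2) by blast
    then show ?thesis
      unfolding set_add_def' cgenideal_def by blast
  qed
  have "primeideal P R"
  proof (rule primeidealI[OF P(1) is_cring])
    show "carrier R \<noteq> P" using P(3) S by blast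
    fix a b assume ab: "a \<in> carrier R" "b \<in> carrier R" "a \<otimes> b \<in> P"
    show "a \<in> P \<or> b \<in> P"
    proof (rule ccontr)
      assume "\<not> (a \<in> P \<or> b \<in> P)"
      then obtain p r q s where *: "p \<in> P" "r \<in> carrier R" "p \<oplus> r \<otimes> a \<in> S"
          "q \<in> P" "s \<in> carrier R" "q \<oplus> s \<otimes> b \<in> S"
        using meets ab by metis
      note carr = ab(1,2) *(2,5) P.Icarr[OF *(1)] P.Icarr[OF *(4)]
      have "(p \<oplus> r \<otimes> a) \<otimes> (q \<oplus> s \<otimes> b) = p \<otimes> (q \<oplus> s \<otimes> b) \<oplus> (r \<otimes> a \<otimes> q \<oplus> r \<otimes> s \<otimes> (a \<otimes> b))"
        using carr by algebra
      also have "\<dots> \<in> P"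
        using carr ab(3) *(1,4) by (simp add: P.I_l_closed P.I_r_closed)
      finally show False
        using mult[OF *(3,6)] P(3) by blast
    qed
  qed
  then show ?thesis using P by blast
qed

text \<open>
  Let \<open>x\<close> be the last of the \<open>k + 1\<close> elements and \<open>J\<close> the ideal of the ones before. The multiplicative
  set of all \<open>x\<^sup>l s\<close> with \<open>s \<notin> Q\<close> misses \<open>J\<close>: cancelling the nonzerodivisor \<open>x\<close> would put \<open>s\<close> into
  \<open>J \<subseteq> Q\<close>. A prime over \<open>J\<close> that avoids it lies strictly inside \<open>Q\<close>, and the induction goes on below it.
\<close>

lemma (in cring) regular_sequence_prime_chain:
  assumes "regular_sequence R xs" "k \<le> length xs" "primeideal Q R" "set (take k xs) \<subseteq> Q"
  shows "\<exists>P. (\<forall>i\<le>k. primeideal (P i) R) \<and> (\<forall>i<k. P i \<subset> P (Suc i)) \<and> P k = Q"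
  using assms(2-)
proof (induction k arbitrary: Q)
  case 0
  then show ?case by (intro exI[of _ "\<lambda>_. Q"]) auto
next
  case (Suc k)
  interpret Q: primeideal Q R by fact
  let ?J = "Idl (set (take k xs))" and ?x = "xs ! k"
  have k: "k < length xs" using Suc.prems(1) by simp
  have sub: "set (take k xs) \<subseteq> carrier R" and x: "?x \<in> carrier R"
    using assms(1) set_take_subset[of k xs] nth_mem[OF k] unfolding regular_sequence_def by auto
  have reg: "a \<in> ?J" if "a \<in> carrier R" "?x \<otimes> a \<in> ?J" for a
    using assms(1) k that unfolding regular_sequence_def by simp
  have J: "ideal ?J R" by (rule genideal_ideal[OF sub])
  have xQ: "?x \<in> Q" and "set (take k xs) \<subseteq> Q"
    using Suc.prems(3) k by (auto simp: take_Suc_conv_app_nth)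
  then have JQ: "?J \<subseteq> Q" using genideal_minimal[OF Q.is_ideal] by simp
  define S where "S = {?x [^] (l::nat) \<otimes> s | l s. s \<in> carrier R - Q}"
  have one: "\<one> \<notin> Q" using Q.I_notcarr Q.one_imp_carrier by auto
  have avoid: "a \<in> ?J" if "a \<in> carrier R" "?x [^] (l::nat) \<otimes> a \<in> ?J" for l a
    using that
  proof (induction l)
    case (Suc l)
    have "?x \<otimes> (?x [^] l \<otimes> a) = ?x [^] Suc l \<otimes> a"
      using x Suc.prems(1) by (simp add: m_ac)
    then show ?case using Suc reg[of "?x [^] l \<otimes> a"] x by auto
  qed simp
  have "\<exists>P. primeideal P R \<and> ?J \<subseteq> P \<and> P \<inter> S = {}"
  proof (rule exists_primeideal_avoiding[OF J])
    show "S \<subseteq> carrier R" using x by (auto simp: S_def)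
    show "S \<noteq> {}" using one by (auto simp: S_def)
    fix u v assume "u \<in> S" "v \<in> S"
    then obtain l s l' s' where uv: "u = ?x [^] (l::nat) \<otimes> s" "s \<in> carrier R" "s \<notin> Q"
        "v = ?x [^] (l'::nat) \<otimes> s'" "s' \<in> carrier R" "s' \<notin> Q" by (auto simp: S_def)
    then have "u \<otimes> v = ?x [^] (l + l') \<otimes> (s \<otimes> s')"
      using x by (simp add: nat_pow_mult[symmetric] m_ac)
    moreover have "s \<otimes> s' \<notin> Q" using Q.I_prime uv by blast
    ultimately show "u \<otimes> v \<in> S" using uv by (force simp: S_def)
  next
    show "?J \<inter> S = {}" using avoid JQ by (auto simp: S_def)
  qed
  then obtain P where P: "primeideal P R" "?J \<subseteq> P" "P \<inter> S = {}" by blast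
  interpret P: primeideal P R by fact
  have "s \<in> S" if "s \<in> carrier R - Q" for s
    unfolding S_def mem_Collect_eq using that by (intro exI[of _ "0::nat"] exI[of _ s]) simp
  then have "P \<subseteq> Q" using P(3) P.a_subset by blast
  moreover have "?x [^] (1::nat) \<otimes> \<one> \<in> S" unfolding S_def using one by blast
  then have "?x \<notin> P" using P(3) x by auto
  ultimately have "P \<subset> Q" using xQ by blast
  obtain C where C: "\<forall>i\<le>k. primeideal (C i) R" "\<forall>i<k. C i \<subset> C (Suc i)" "C k = P"
    using Suc.IH[OF _ P(1)] Suc.prems(1) P(2) genideal_self[OF sub] by auto
  show ?case
    using C \<open>P \<subset> Q\<close> Suc.prems(2)
    by (intro exI[of _ "\<lambda>i. if i = Suc k then Q else C i"]) (auto simp: less_Suc_eq le_Suc_eq)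
qed

lemma (in cring) depth_le_krull_dim: "depth R J \<le> krull_dim R"
  unfolding depth_def
proof (rule Sup_least, safe)
  fix xs assume xs: "regular_sequence R xs"
  then have carr: "set xs \<subseteq> carrier R" and "Idl (set xs) \<noteq> carrier R"
    by (auto simp: regular_sequence_def)
  then have "Idl (set xs) \<inter> {\<one>} = {}"
    using ideal.one_imp_carrier[OF genideal_ideal[OF carr]] by auto
  then obtain Q where Q: "primeideal Q R" "Idl (set xs) \<subseteq> Q"
    using exists_primeideal_avoiding[OF genideal_ideal[OF carr], of "{\<one>}"] by auto
  then have "set xs \<subseteq> Q" using genideal_self[OF carr] by blast
  from regular_sequence_prime_chain[OF xs order_refl Q(1)] this
  obtain P where "\<forall>i\<le>length xs. primeideal (P i) R" "\<forall>i<length xs. P i \<subset> P (Suc i)" by auto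
  then show "enat (length xs) \<le> krull_dim R"
    unfolding krull_dim_def by (intro Sup_upper) blast
qed

section \<open>Linear relations, coefficients and ideals of polynomials\<close>

abbreviation (input) "lookup \<equiv> Poly_Mapping.lookup"
abbreviation (input) "single \<equiv> Poly_Mapping.single"
abbreviation (input) "keys \<equiv> Poly_Mapping.keys"

text \<open>
  A homogeneous linear system with more unknowns than equations has a nontrivial solution. The rows are
  indexed by \<open>F\<close>, the unknowns by \<open>U\<close>; one equation is eliminated in each step, by solving it for an
  unknown with a nonzero coefficient.
\<close>

lemma exists_nontrivial_relation:
  fixes M :: "'e \<Rightarrow> 'u \<Rightarrow> 'k::field"
  assumes "finite F" "finite U" "card F < card U"
  shows "\<exists>c. (\<exists>u\<in>U. c u \<noteq> 0) \<and> (\<forall>e\<in>F. (\<Sum>u\<in>U. c u * M e u) = 0)"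
  using assms
proof (induction F arbitrary: U M rule: finite_induct)
  case empty
  then have "U \<noteq> {}" by auto
  then show ?case by (intro exI[of _ "\<lambda>_. 1"]) auto
next
  case (insert e F)
  show ?case
  proof (cases "\<forall>u\<in>U. M e u = 0")
    case True
    have "card F < card U" using insert by simp
    from insert.IH[OF insert.prems(1) this, of M] show ?thesis using True by auto
  next
    case False
    then obtain v where v: "v \<in> U" "M e v \<noteq> 0" by blast
    let ?U = "U - {v}" and ?M = "\<lambda>e' u. M e' u - M e' v * M e u / M e v"
    have "card F < card ?U" using insert v by simp
    then obtain c where c: "\<exists>u\<in>?U. c u \<noteq> 0" "\<forall>e'\<in>F. (\<Sum>u\<in>?U. c u * ?M e' u) = 0"
      using insert.IH[of ?U ?M] insert.prems by auto
    define d where "d = c (v := - (\<Sum>u\<in>?U. c u * M e u) / M e v)"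
    have d: "(\<Sum>u\<in>U. d u * M e' u) = (\<Sum>u\<in>?U. c u * ?M e' u)" for e'
    proof -
      have "(\<Sum>u\<in>U. d u * M e' u) = d v * M e' v + (\<Sum>u\<in>?U. d u * M e' u)"
        using insert.prems v by (simp add: sum.remove)
      also have "(\<Sum>u\<in>?U. d u * M e' u) = (\<Sum>u\<in>?U. c u * M e' u)"
        by (rule sum.cong) (auto simp: d_def)
      also have "d v * M e' v = - (\<Sum>u\<in>?U. c u * (M e' v * M e u / M e v))"
        by (simp add: d_def sum_distrib_right sum_distrib_left sum_divide_distrib mult_ac)
      finally show ?thesis
        by (simp add: right_diff_distrib sum_subtractf)
    qed
    have "(\<Sum>u\<in>?U. c u * ?M e u) = 0" using v by simp
    then have "\<forall>e'\<in>insert e F. (\<Sum>u\<in>U. d u * M e' u) = 0"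
      unfolding d using c(2) by simp
    moreover have "\<exists>u\<in>U. d u \<noteq> 0" using c(1) by (auto simp: d_def)
    ultimately show ?thesis by blast
  qed
qed

lemma lookup_single_mult:
  fixes p :: "'k::comm_ring_1 mpoly"
  shows "lookup (single u c * p) (u + s) = c * lookup p s"
proof -
  have "lookup (single u c * p) (u + s) =
      (\<Sum>t\<in>keys p. lookup (single (u + t) (c * lookup p t)) (u + s))"
    by (subst poly_mapping_sum_singles[of p]) (simp add: sum_distrib_left mult_single lookup_sum)
  also have "\<dots> = (\<Sum>t\<in>keys p. if t = s then c * lookup p t else 0)"
    by (rule sum.cong) (auto simp: lookup_single when_def)
  also have "\<dots> = c * lookup p s"
    by (simp add: in_keys_iff)
  finally show ?thesis .
qed

lemma lookup_Const_mult: "lookup (Const c * p) t = c * lookup (p :: 'k::comm_ring_1 mpoly) t"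
  using lookup_single_mult[of 0 c p t] by (simp add: Const_def)

lemma lookup_Var_mult:
  fixes p :: "'k::comm_ring_1 mpoly"
  shows "lookup (Var l * p) t = (if lookup t l = 0 then 0 else lookup p (t - single l 1))"
proof (cases "lookup t l = 0")
  case True
  have "t \<notin> keys (Var l * p)"
  proof
    assume "t \<in> keys (Var l * p)"
    then obtain s where "t = single l 1 + s"
      using keys_mult[of "Var l" p] by (auto simp: Var_def)
    then show False using True by (simp add: lookup_add)
  qed
  then show ?thesis using True by (simp add: in_keys_iff)
next
  case False
  have "t = single l 1 + (t - single l 1)"
    by (rule poly_mapping_eqI) (use False in \<open>auto simp: lookup_add lookup_minus lookup_single when_def\<close>)
  then show ?thesis
    using lookup_single_mult[of "single l 1" 1 p "t - single l 1"] False
    by (simp add: Var_def)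
qed

lemma mpoly_ring_minus_closed:
  fixes p q :: "'k::comm_ring_1 mpoly"
  assumes "p \<in> carrier (mpoly_ring m)" "q \<in> carrier (mpoly_ring m)"
  shows "p - q \<in> carrier (mpoly_ring m)"
  using mpoly_ring_closed(6)[OF assms(1) mpoly_ring_closed(5)[OF assms(2)]] by simp

lemma mpoly_ring_sum_closed:
  fixes f :: "'a \<Rightarrow> 'k::comm_ring_1 mpoly"
  assumes "\<And>a. a \<in> A \<Longrightarrow> f a \<in> carrier (mpoly_ring m)"
  shows "sum f A \<in> carrier (mpoly_ring m)"
  using assms by (induction A rule: infinite_finite_induct) (auto simp: mpoly_ring_closed)

lemma mpoly_ring_prod_closed:
  fixes f :: "'a \<Rightarrow> 'k::comm_ring_1 mpoly"
  assumes "\<And>a. a \<in> A \<Longrightarrow> f a \<in> carrier (mpoly_ring m)"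
  shows "prod f A \<in> carrier (mpoly_ring m)"
  using assms by (induction A rule: infinite_finite_induct) (auto simp: mpoly_ring_closed)

lemma mpoly_ring_power_closed:
  fixes p :: "'k::comm_ring_1 mpoly"
  assumes "p \<in> carrier (mpoly_ring m)"
  shows "p ^ l \<in> carrier (mpoly_ring m)"
  using assms by (induction l) (auto simp: mpoly_ring_closed)

lemma mpoly_ring_a_inv:
  fixes p :: "'k::comm_ring_1 mpoly"
  assumes p: "p \<in> carrier (mpoly_ring m)"
  shows "\<ominus>\<^bsub>mpoly_ring m\<^esub> p = - p"
proof -
  interpret cring "mpoly_ring m :: 'k mpoly ring" by (rule cring_mpoly_ring)
  show ?thesis using minus_equality[of "- p" p] mpoly_ring_closed(5)[OF p] p by simp
qed

lemma mpoly_ring_a_minus: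
  fixes p q :: "'k::comm_ring_1 mpoly"
  assumes "q \<in> carrier (mpoly_ring m)"
  shows "p \<ominus>\<^bsub>mpoly_ring m\<^esub> q = p - q"
  using mpoly_ring_a_inv[OF assms] by (simp add: a_minus_def)

lemma mpoly_idealI:
  fixes I :: "'k::comm_ring_1 mpoly set"
  assumes sub: "I \<subseteq> carrier (mpoly_ring m)" and "0 \<in> I"
    and add: "\<And>p q. p \<in> I \<Longrightarrow> q \<in> I \<Longrightarrow> p + q \<in> I"
    and mult: "\<And>r p. r \<in> carrier (mpoly_ring m) \<Longrightarrow> p \<in> I \<Longrightarrow> r * p \<in> I"
  shows "ideal I (mpoly_ring m)"
proof -
  interpret cring "mpoly_ring m :: 'k mpoly ring" by (rule cring_mpoly_ring)
  show ?thesis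
  proof (rule idealI)
    have inv: "- p \<in> I" if "p \<in> I" for p
      using mult[of "- 1" p] that mpoly_ring_closed(2)[of m] mpoly_ring_closed(5)[of 1 m] by auto
    show "subgroup I (add_monoid (mpoly_ring m))"
    proof (rule add.subgroupI)
      fix p assume "p \<in> I"
      then show "\<ominus>\<^bsub>mpoly_ring m\<^esub> p \<in> I"
        using inv sub mpoly_ring_a_inv[of p m] by auto
    qed (use sub assms(2) add in auto)
    show "p \<otimes>\<^bsub>mpoly_ring m\<^esub> r \<in> I" if "p \<in> I" "r \<in> carrier (mpoly_ring m)" for p r
      using mult[OF that(2,1)] by (simp add: mult.commute)
  qed (auto simp: mult ring_axioms)
qed

lemma mpoly_ideal_sum:
  fixes I :: "'k::comm_ring_1 mpoly set"
  assumes "ideal I (mpoly_ring m)" "\<And>a. a \<in> A \<Longrightarrow> f a \<in> I"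
  shows "sum f A \<in> I"
  using assms(2) additive_subgroup.a_closed[OF ideal.axioms(1)[OF assms(1)]]
    additive_subgroup.zero_closed[OF ideal.axioms(1)[OF assms(1)]]
  by (induction A rule: infinite_finite_induct) auto

section \<open>The edge ideal of the complement of a triangle-free graph\<close>

locale connected_triangle_free_graph =
  fixes m :: nat and E :: "nat set set"
  assumes edge: "e \<in> E \<Longrightarrow> e \<subseteq> {1..m} \<and> card e = 2"
    and nonempty: "E \<noteq> {}"
    and connected: "i \<in> {1..m} \<Longrightarrow> j \<in> {1..m} \<Longrightarrow> (i, j) \<in> {(a, b). {a, b} \<in> E}\<^sup>*"
    and triangle_free: "{i, j} \<in> E \<Longrightarrow> {j, k} \<in> E \<Longrightarrow> {i, k} \<notin> E"
begin

definition nonedge_ideal :: "'k::field mpoly set"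
  where "nonedge_ideal = edge_ideal m (complement_edges m E)"

lemma edgeD:
  assumes "{i, j} \<in> E"
  shows "i \<noteq> j" "i \<in> {1..m}" "j \<in> {1..m}"
  using edge[OF assms] by (auto simp: card_insert_if split: if_splits)

lemma finite_E: "finite E"
  by (rule finite_subset[of _ "Pow {1..m}"]) (use edge in auto)

lemma has_neighbour:
  assumes "i \<in> {1..m}"
  obtains j where "{i, j} \<in> E"
proof -
  obtain k l where kl: "{k, l} \<in> E"
    using nonempty edge by (metis card_2_iff equals0I)
  show ?thesis
  proof (cases "i = k")
    case False
    have "(i, k) \<in> {(a, b). {a, b} \<in> E}\<^sup>*" using connected assms edgeD[OF kl] by simp
    then show ?thesis using False that by (cases rule: converse_rtranclE) auto
  qed (use kl that in blast)
qed

text \<open>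
  This is where the absence of triangles and of isolated vertices enters: the edges are precisely the
  maximal cliques.
\<close>

lemma clique_cases:
  assumes sub: "K \<subseteq> {1..m}" and clique: "\<And>k l. k \<in> K \<Longrightarrow> l \<in> K \<Longrightarrow> k \<noteq> l \<Longrightarrow> {k, l} \<in> E"
  obtains i j where "{i, j} \<in> E" "K \<subseteq> {i, j}"
proof -
  consider "K = {}" | i where "K = {i}" | i j where "i \<in> K" "j \<in> K" "i \<noteq> j" by blast
  then show ?thesis
  proof cases
    case 1
    then show ?thesis using nonempty edge that by (metis card_2_iff empty_subsetI equals0I)
  next
    case 2
    then show ?thesis using has_neighbour[of i] sub that by auto
  next
    case 3
    have "K \<subseteq> {i, j}"
    proof
      fix k assume k: "k \<in> K"
      show "k \<in> {i, j}"
      proof (rule ccontr)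
        assume "k \<notin> {i, j}"
        then show False using clique[of i j] clique[of j k] clique[of i k] triangle_free[of i j k] 3 k by auto
      qed
    qed
    then show ?thesis using clique 3 that by blast
  qed
qed

lemma edge_monomial_eq:
  fixes t :: "nat \<Rightarrow>\<^sub>0 nat"
  assumes "keys t \<subseteq> {i, j}" "i \<noteq> j"
  shows "t = single i (lookup t i) + single j (lookup t j)"
  by (rule poly_mapping_eqI) (use assms in \<open>auto simp: lookup_add lookup_single when_def in_keys_iff\<close>)

text \<open>Every divisor of a monomial supported on an edge is again supported on that edge.\<close>

lemma ideal_vanishing:
  "ideal {p \<in> carrier (mpoly_ring m :: 'k::field mpoly ring).
     \<forall>i j a b. {i, j} \<in> E \<longrightarrow> lookup p (single i a + single j b) = 0} (mpoly_ring m)"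
proof (rule mpoly_idealI, goal_cases)
  case (4 r p)
  have "lookup (r * p) (single i a + single j b) = 0" if ij: "{i, j} \<in> E" for i j a b
  proof (rule ccontr)
    assume "lookup (r * p) (single i a + single j b) \<noteq> 0"
    then have "single i a + single j b \<in> keys (r * p)" by (simp add: in_keys_iff)
    then obtain u v where uv: "single i a + single j b = u + v" "v \<in> keys p"
      using keys_mult[of r p] by auto
    have "keys v \<subseteq> {i, j}"
    proof
      fix k assume "k \<in> keys v"
      moreover have "lookup (single i a + single j b) k = lookup u k + lookup v k"
        unfolding uv(1) by (simp add: lookup_add)
      ultimately show "k \<in> {i, j}"
        by (auto simp: lookup_add lookup_single in_keys_iff when_def split: if_splits)
    qed
    then have "v = single i (lookup v i) + single j (lookup v j)"
      by (rule edge_monomial_eq[OF _ edgeD(1)[OF ij]])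
    moreover have "lookup p (single i (lookup v i) + single j (lookup v j)) = 0"
      using 4 ij by blast
    ultimately have "lookup p v = 0" by simp
    then show False using uv(2) by (simp add: in_keys_iff)
  qed
  then show ?case using 4 by (auto intro: mpoly_ring_closed)
qed (auto simp: mpoly_ring_closed lookup_add)

lemma ideal_nonedge_ideal: "ideal (nonedge_ideal :: 'k::field mpoly set) (mpoly_ring m)"
  and nonedge_gens: "{k, l} \<in> complement_edges m E \<Longrightarrow> Var k * Var l \<in> (nonedge_ideal :: 'k::field mpoly set)"
proof -
  interpret cring "mpoly_ring m :: 'k mpoly ring" by (rule cring_mpoly_ring)
  have *: "{Var i * Var j | i j. {i, j} \<in> complement_edges m E} \<subseteq> carrier (mpoly_ring m :: 'k mpoly ring)"
    by (auto simp: complement_edges_def intro!: mpoly_ring_closed)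
  show "ideal (nonedge_ideal :: 'k mpoly set) (mpoly_ring m)"
    unfolding nonedge_ideal_def edge_ideal_def by (rule genideal_ideal[OF *])
  show "{k, l} \<in> complement_edges m E \<Longrightarrow> Var k * Var l \<in> (nonedge_ideal :: 'k mpoly set)"
    unfolding nonedge_ideal_def edge_ideal_def using genideal_self[OF *] by blast
qed

text \<open>
  The ideal is a monomial ideal. A monomial outside it has a clique as its support, hence is supported
  on an edge. The exponents \<open>a\<close>, \<open>b\<close> may be \<open>0\<close>, so that powers of a single variable and the constant
  monomial are covered, each of them by several edges.
\<close>

lemma mem_nonedge_ideal_iff:
  fixes p :: "'k::field mpoly"
  shows "p \<in> nonedge_ideal \<longleftrightarrow> p \<in> carrier (mpoly_ring m) \<and>
    (\<forall>i j a b. {i, j} \<in> E \<longrightarrow> lookup p (single i a + single j b) = 0)"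
    (is "_ \<longleftrightarrow> ?R p")
proof
  interpret cring "mpoly_ring m :: 'k mpoly ring" by (rule cring_mpoly_ring)
  assume p: "p \<in> nonedge_ideal"
  have "(nonedge_ideal :: 'k mpoly set) \<subseteq> {p \<in> carrier (mpoly_ring m).
     \<forall>i j a b. {i, j} \<in> E \<longrightarrow> lookup p (single i a + single j b) = 0}"
    unfolding nonedge_ideal_def edge_ideal_def
  proof (rule genideal_minimal[OF ideal_vanishing], safe)
    fix k l assume kl: "{k, l} \<in> complement_edges m E"
    then show "Var k * Var l \<in> carrier (mpoly_ring m :: 'k mpoly ring)"
      by (auto simp: complement_edges_def intro!: mpoly_ring_closed)
    have neq: "k \<noteq> l" using kl by (auto simp: complement_edges_def)
    fix i j a b assume ij: "{i, j} \<in> E"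
    have "single k (1::nat) + single l 1 \<noteq> single i a + single j b"
    proof
      assume *: "single k (1::nat) + single l 1 = single i a + single j b"
      have "x \<in> {i, j}" if "x \<in> {k, l}" for x
        using arg_cong[OF *, of "\<lambda>t. lookup t x"] that
        by (auto simp: lookup_add lookup_single when_def split: if_splits)
      then have "{k, l} = {i, j}" using neq by auto
      then show False using kl ij by (auto simp: complement_edges_def)
    qed
    then show "lookup (Var k * Var l :: 'k mpoly) (single i a + single j b) = 0"
      by (simp add: Var_def mult_single lookup_single when_def)
  qed
  then show "?R p" using p by blast
next
  assume R: "?R p"
  have "single t (lookup p t) \<in> (nonedge_ideal :: 'k mpoly set)" if t: "t \<in> keys p" for t
  proof -
    have sub: "keys t \<subseteq> {1..m}" using R t by (auto simp: carrier_mpoly_ring_iff)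
    have "\<not> (\<forall>k\<in>keys t. \<forall>l\<in>keys t. k \<noteq> l \<longrightarrow> {k, l} \<in> E)"
    proof
      assume "\<forall>k\<in>keys t. \<forall>l\<in>keys t. k \<noteq> l \<longrightarrow> {k, l} \<in> E"
      then obtain i j where ij: "{i, j} \<in> E" "keys t \<subseteq> {i, j}"
        using clique_cases[OF sub] by blast
      then have "t = single i (lookup t i) + single j (lookup t j)"
        using edge_monomial_eq edgeD(1) by blast
      then have "lookup p t = 0" using R ij(1) by metis
      then show False using t by (simp add: in_keys_iff)
    qed
    then obtain k l where kl: "k \<in> keys t" "l \<in> keys t" "k \<noteq> l" "{k, l} \<notin> E" by blast
    then have "{k, l} \<in> complement_edges m E" using sub by (auto simp: complement_edges_def)
    then have mem: "Var k * Var l \<in> (nonedge_ideal :: 'k mpoly set)" by (rule nonedge_gens)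
    let ?q = "single (t - (single k 1 + single l 1)) (lookup p t)"
    have q: "?q \<in> carrier (mpoly_ring m)"
      using sub by (auto simp: carrier_mpoly_ring_iff in_keys_iff lookup_minus split: if_splits)
    have "t = (single k 1 + single l 1) + (t - (single k 1 + single l 1))"
      by (rule poly_mapping_eqI) (use kl in \<open>auto simp: lookup_add lookup_minus lookup_single when_def in_keys_iff\<close>)
    then have "single t (lookup p t) = Var k * Var l * ?q"
      by (simp add: Var_def mult_single)
    then show ?thesis
      using ideal.I_r_closed[OF ideal_nonedge_ideal mem q] by simp
  qed
  then have "(\<Sum>t\<in>keys p. single t (lookup p t)) \<in> nonedge_ideal"
    by (rule mpoly_ideal_sum[OF ideal_nonedge_ideal])
  then show "p \<in> nonedge_ideal" using poly_mapping_sum_singles[of p] by simp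
qed

end

section \<open>The dimension is at most two\<close>

definition exponents_le :: "nat \<Rightarrow> 'k::comm_ring_1 mpoly \<Rightarrow> bool"
  where "exponents_le L p \<longleftrightarrow> (\<forall>t\<in>keys p. \<forall>i. lookup t i \<le> L)"

lemma exponents_le_mono: "exponents_le L p \<Longrightarrow> L \<le> M \<Longrightarrow> exponents_le M p"
  unfolding exponents_le_def by (meson order_trans)

lemma exponents_le_mult:
  assumes "exponents_le L p" "exponents_le M q"
  shows "exponents_le (L + M) (p * q)"
  unfolding exponents_le_def
proof (intro ballI allI)
  fix t i assume "t \<in> keys (p * q)"
  then obtain u v where "t = u + v" "u \<in> keys p" "v \<in> keys q" using keys_mult[of p q] by auto
  then show "lookup t i \<le> L + M"
    using assms by (simp add: exponents_le_def lookup_add add_mono)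
qed

lemma exponents_le_power: "exponents_le L p \<Longrightarrow> exponents_le (n * L) (p ^ n)"
proof (induction n)
  case (Suc n)
  then show ?case using exponents_le_mult[of L p "n * L" "p ^ n"] by simp
qed (simp add: exponents_le_def)

lemma exponents_le_exists: "\<exists>L. exponents_le L p"
proof -
  have "lookup t i \<le> (\<Sum>t\<in>keys p. \<Sum>i\<in>keys t. lookup t i)" if t: "t \<in> keys p" for t i
  proof -
    have "lookup t i \<le> (\<Sum>i\<in>keys t. lookup t i)"
      by (cases "i \<in> keys t") (auto intro: member_le_sum simp: in_keys_iff)
    also have "\<dots> \<le> (\<Sum>t\<in>keys p. \<Sum>i\<in>keys t. lookup t i)"
      using t by (intro member_le_sum) auto
    finally show ?thesis .
  qed
  then show ?thesis unfolding exponents_le_def by blast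
qed

lemma Const_zero: "Const 0 = 0"
  by (simp add: Const_def)

lemma carrier_FactRing: "carrier (R Quot I) = a_r_coset R I ` carrier R"
  by (auto simp: FactRing_def A_RCOSETS_def')

lemma primeideal_subset: "primeideal P R \<Longrightarrow> P \<subseteq> carrier R"
  and primeideal_zero_mem: "primeideal P R \<Longrightarrow> \<zero>\<^bsub>R\<^esub> \<in> P"
  unfolding primeideal_def ideal_def
  by (auto dest: additive_subgroup.a_subset additive_subgroup.zero_closed)

text \<open>
  Modulo \<open>P\<close> the relation reads \<open>x\<^sup>n (q\<^sub>n + x s) = 0\<close>. As \<open>P\<close> is prime and omits \<open>x\<close>, the bracket lies in
  \<open>P\<close>, and in \<open>Q\<close>, where also \<open>x s\<close> lies.
\<close>

lemma lowest_coefficient_mem: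
  fixes q :: "nat \<Rightarrow> 'k::field mpoly"
  assumes P: "primeideal P (mpoly_ring m)" and Q: "primeideal Q (mpoly_ring m)"
    and sub: "P \<subseteq> Q" and x: "x \<in> Q" "x \<notin> P"
    and q: "\<And>a. q a \<in> carrier (mpoly_ring m)"
    and rel: "(\<Sum>a\<le>N. x ^ a * q a) \<in> P"
    and low: "\<And>a. a < n \<Longrightarrow> q a = 0" and "n \<le> N"
  shows "q n \<in> Q"
proof -
  interpret P: primeideal P "mpoly_ring m :: 'k mpoly ring" by fact
  interpret Q: primeideal Q "mpoly_ring m :: 'k mpoly ring" by fact
  have xc: "x \<in> carrier (mpoly_ring m)" using Q.Icarr x by blast
  define s where "s = (\<Sum>a\<in>{n<..N}. x ^ (a - n - 1) * q a)"
  have s: "s \<in> carrier (mpoly_ring m)"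
    unfolding s_def by (intro mpoly_ring_sum_closed mpoly_ring_closed mpoly_ring_power_closed xc q)
  have "(\<Sum>a\<le>N. x ^ a * q a) = (\<Sum>a\<in>{n..N}. x ^ a * q a)"
    by (intro sum.mono_neutral_right) (auto simp: low)
  also have "{n..N} = insert n {n<..N}" using \<open>n \<le> N\<close> by auto
  also have "(\<Sum>a\<in>insert n {n<..N}. x ^ a * q a) = x ^ n * q n + (\<Sum>a\<in>{n<..N}. x ^ a * q a)"
    by simp
  also have "(\<Sum>a\<in>{n<..N}. x ^ a * q a) = x ^ n * (x * s)"
    unfolding s_def sum_distrib_left
  proof (rule sum.cong)
    fix a assume "a \<in> {n<..N}"
    then have "x ^ a = x ^ n * (x * x ^ (a - n - 1))"
      by (simp flip: power_add power_Suc)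
    then show "x ^ a * q a = x ^ n * (x * (x ^ (a - n - 1) * q a))" by (simp add: mult.assoc)
  qed simp
  also have "x ^ n * q n + x ^ n * (x * s) = x ^ n * (q n + x * s)" by (simp add: distrib_left)
  finally have *: "x ^ n * (q n + x * s) \<in> P" using rel by simp
  have pow: "x ^ l \<notin> P" for l
  proof (induction l)
    case 0
    then show ?case using P.I_notcarr P.one_imp_carrier by auto
  next
    case (Suc l)
    then show ?case using P.I_prime[OF xc mpoly_ring_power_closed[OF xc, of l]] x by auto
  qed
  have sum: "q n + x * s \<in> carrier (mpoly_ring m)" by (intro mpoly_ring_closed q xc s)
  have "q n + x * s \<in> P"
    using P.I_prime[OF mpoly_ring_power_closed[OF xc, of n] sum] * pow by auto
  then have 1: "q n + x * s \<in> Q" using sub by blast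
  have "x * (- s) \<in> Q" using Q.I_r_closed[OF x(1) mpoly_ring_closed(5)[OF s]] by simp
  then have "(q n + x * s) + x * (- s) \<in> Q" using Q.additive_subgroup_axioms 1
    using additive_subgroup.a_closed[of Q "mpoly_ring m"] by fastforce
  then show ?thesis by simp
qed

context connected_triangle_free_graph
begin

text \<open>
  The unknowns are the coefficients \<open>c a b d\<close> with \<open>a, b, d \<le> N\<close>; there is one equation for each monomial
  supported on a pair of vertices with exponents at most \<open>L\<close>. Beyond \<open>L\<close> the coefficients of
  \<open>x\<^sup>a y\<^sup>b z\<^sup>d\<close> vanish anyway. The relation is stated as a nested sum so that its lowest coefficients
  can be peeled off one variable at a time.
\<close>

lemma algebraically_dependent_mod_nonedge_ideal:
  fixes x y z :: "'k::field mpoly"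
  assumes x: "x \<in> carrier (mpoly_ring m)" and y: "y \<in> carrier (mpoly_ring m)" and z: "z \<in> carrier (mpoly_ring m)"
  shows "\<exists>N c. (\<exists>a\<le>N. \<exists>b\<le>N. \<exists>d\<le>N. c a b d \<noteq> 0) \<and>
    (\<Sum>a\<le>N. x ^ a * (\<Sum>b\<le>N. y ^ b * (\<Sum>d\<le>N. z ^ d * Const (c a b d)))) \<in> nonedge_ideal"
proof -
  obtain D1 D2 D3 where "exponents_le D1 x" "exponents_le D2 y" "exponents_le D3 z"
    using exponents_le_exists by metis
  then obtain D where D: "exponents_le D x" "exponents_le D y" "exponents_le D z"
    using exponents_le_mono[of _ _ "D1 + D2 + D3"] by (metis le_add1 le_add2 trans_le_add1)
  \<comment> \<open>With this \<open>N\<close> there are at most \<open>m\<^sup>2 (L + 1)\<^sup>2 \<le> N (N + 1)\<^sup>2\<close> equations for \<open>(N + 1)\<^sup>3\<close> unknowns.\<close>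
  define N where "N = m * m * (3 * D + 1) ^ 2"
  define L where "L = 3 * D * N"
  define F where "F = (\<lambda>(i, j, a, b). single i a + single j b) ` ({1..m} \<times> {1..m} \<times> {..L} \<times> {..L})"
  define U where "U = {..N} \<times> {..N} \<times> {..N}"
  define M where "M t u = lookup (case u of (a, b, d) \<Rightarrow> x ^ a * (y ^ b * z ^ d)) t" for t u
  have "card F \<le> card ({1..m} \<times> {1..m} \<times> {..L} \<times> {..L})"
    unfolding F_def by (rule card_image_le) simp
  also have "\<dots> = m * m * (L + 1) ^ 2" by (simp add: power2_eq_square algebra_simps)
  also have "\<dots> \<le> m * m * ((3 * D + 1) * (N + 1)) ^ 2"
    by (intro mult_le_mono2 power_mono) (simp_all add: L_def)
  also have "\<dots> = N * (N + 1) ^ 2" unfolding power_mult_distrib by (simp add: N_def)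
  also have "\<dots> < card U" by (simp add: U_def power2_eq_square)
  finally have "card F < card U" .
  moreover have "finite F" "finite U" by (auto simp: F_def U_def)
  ultimately obtain c where c: "\<exists>u\<in>U. c u \<noteq> 0" "\<forall>t\<in>F. (\<Sum>u\<in>U. c u * M t u) = 0"
    using exists_nontrivial_relation[of F U M] by blast
  define r where "r = (\<Sum>a\<le>N. x ^ a * (\<Sum>b\<le>N. y ^ b * (\<Sum>d\<le>N. z ^ d * Const (c (a, b, d)))))"
  have "r = (\<Sum>a\<le>N. \<Sum>b\<le>N. \<Sum>d\<le>N. Const (c (a, b, d)) * (x ^ a * (y ^ b * z ^ d)))"
    unfolding r_def by (simp add: sum_distrib_left mult_ac)
  then have r: "r = (\<Sum>u\<in>U. Const (c u) * (case u of (a, b, d) \<Rightarrow> x ^ a * (y ^ b * z ^ d)))"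
    by (simp add: U_def sum.cartesian_product case_prod_unfold)
  have lookup_r: "lookup r t = (\<Sum>u\<in>U. c u * M t u)" for t
    unfolding r M_def by (simp add: lookup_sum lookup_Const_mult)
  have "exponents_le L (x ^ a * (y ^ b * z ^ d))" if "a \<le> N" "b \<le> N" "d \<le> N" for a b d
  proof (rule exponents_le_mono)
    show "exponents_le (a * D + (b * D + d * D)) (x ^ a * (y ^ b * z ^ d))"
      by (intro exponents_le_mult exponents_le_power D)
    have "a * D + (b * D + d * D) \<le> N * D + (N * D + N * D)"
      by (intro add_mono mult_right_mono that) auto
    also have "\<dots> = L" unfolding L_def by simp
    finally show "a * D + (b * D + d * D) \<le> L" .
  qed
  then have bound: "exponents_le L (case u of (a, b, d) \<Rightarrow> x ^ a * (y ^ b * z ^ d))" if "u \<in> U" for u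
    using that by (cases u) (simp add: U_def)
  have M0: "M t u = 0" if "u \<in> U" "lookup t i > L" for t u i
    using bound[OF that(1)] that(2) unfolding M_def exponents_le_def by (metis in_keys_iff not_le)
  have "lookup r (single i a + single j b) = 0" if ij: "{i, j} \<in> E" for i j a b
  proof (cases "a \<le> L \<and> b \<le> L")
    case True
    then have "(i, j, a, b) \<in> {1..m} \<times> {1..m} \<times> {..L} \<times> {..L}"
      using edgeD[OF ij] by simp
    from imageI[OF this, of "\<lambda>(i, j, a, b). single i a + single j b"]
    have "single i a + single j b \<in> F" unfolding F_def by simp
    then show ?thesis using c(2) lookup_r by simp
  next
    case False
    let ?t = "single i a + single j b"
    have "lookup ?t i = a" "lookup ?t j = b"
      using edgeD(1)[OF ij] by (auto simp: lookup_add lookup_single when_def)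
    then have "M ?t u = 0" if "u \<in> U" for u
      using M0[OF that, of ?t i] M0[OF that, of ?t j] False by auto
    then show ?thesis unfolding lookup_r by simp
  qed
  moreover have "r \<in> carrier (mpoly_ring m)"
    unfolding r_def
    by (intro mpoly_ring_sum_closed mpoly_ring_closed mpoly_ring_power_closed x y z)
  ultimately have "r \<in> nonedge_ideal" unfolding mem_nonedge_ideal_iff by blast
  then show ?thesis
    using c(1) unfolding r_def U_def
    by (intro exI[of _ N] exI[of _ "\<lambda>a b d. c (a, b, d)"]) auto
qed

lemma no_prime_chain_of_length_3:
  fixes P :: "nat \<Rightarrow> 'k::field mpoly set"
  assumes P: "\<And>i. i \<le> 3 \<Longrightarrow> primeideal (P i) (mpoly_ring m)" and chain: "\<And>i. i < 3 \<Longrightarrow> P i \<subset> P (Suc i)"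
    and sub: "nonedge_ideal \<subseteq> P 0"
  shows False
proof -
  have chain': "P 0 \<subset> P 1" "P 1 \<subset> P 2" "P 2 \<subset> P 3"
    using chain[of 0] chain[of 1] chain[of 2] by (simp_all add: eval_nat_numeral)
  obtain x where x: "x \<in> P 1" "x \<notin> P 0" using chain'(1) by blast
  obtain y where y: "y \<in> P 2" "y \<notin> P 1" using chain'(2) by blast
  obtain z where z: "z \<in> P 3" "z \<notin> P 2" using chain'(3) by blast
  have carr: "p \<in> carrier (mpoly_ring m)" if "p \<in> P i" "i \<le> 3" for p i
    using that primeideal_subset[OF P] by blast
  note xyz = carr[OF x(1)] carr[OF y(1)] carr[OF z(1)]
  obtain N c where nz: "\<exists>a\<le>N. \<exists>b\<le>N. \<exists>d\<le>N. c a b d \<noteq> 0" and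
    rel: "(\<Sum>a\<le>N. x ^ a * (\<Sum>b\<le>N. y ^ b * (\<Sum>d\<le>N. z ^ d * Const (c a b d)))) \<in> (nonedge_ideal :: 'k mpoly set)"
    using algebraically_dependent_mod_nonedge_ideal[of x y z] xyz by force
  note closed = mpoly_ring_sum_closed mpoly_ring_closed mpoly_ring_power_closed
  \<comment> \<open>The exponents of the lexicographically lowest monomial of the relation are found in turn.\<close>
  define a where "a = (LEAST a. a \<le> N \<and> (\<exists>b\<le>N. \<exists>d\<le>N. c a b d \<noteq> 0))"
  have a: "a \<le> N" "\<exists>b\<le>N. \<exists>d\<le>N. c a b d \<noteq> 0"
    using LeastI_ex[of "\<lambda>a. a \<le> N \<and> (\<exists>b\<le>N. \<exists>d\<le>N. c a b d \<noteq> 0)"] nz unfolding a_def by blast+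
  have "\<forall>b\<le>N. \<forall>d\<le>N. c a' b d = 0" if "a' < a" for a'
    using not_less_Least[OF that[unfolded a_def]] a(1) that by auto
  then have 1: "(\<Sum>b\<le>N. y ^ b * (\<Sum>d\<le>N. z ^ d * Const (c a b d))) \<in> P 1"
    using lowest_coefficient_mem[OF P[of 0] P[of 1] _ x, of "\<lambda>a. \<Sum>b\<le>N. y ^ b * (\<Sum>d\<le>N. z ^ d * Const (c a b d))" N a]
      chain'(1) rel sub xyz a(1) by (simp add: closed Const_zero subset_iff psubset_eq)
  define b where "b = (LEAST b. b \<le> N \<and> (\<exists>d\<le>N. c a b d \<noteq> 0))"
  have b: "b \<le> N" "\<exists>d\<le>N. c a b d \<noteq> 0"
    using LeastI_ex[of "\<lambda>b. b \<le> N \<and> (\<exists>d\<le>N. c a b d \<noteq> 0)"] a(2) unfolding b_def by blast+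
  have "\<forall>d\<le>N. c a b' d = 0" if "b' < b" for b'
    using not_less_Least[OF that[unfolded b_def]] b(1) that by auto
  then have 2: "(\<Sum>d\<le>N. z ^ d * Const (c a b d)) \<in> P 2"
    using lowest_coefficient_mem[OF P[of 1] P[of 2] _ y, of "\<lambda>b. \<Sum>d\<le>N. z ^ d * Const (c a b d)" N b]
      chain'(2) 1 xyz b(1) by (simp add: closed Const_zero psubset_eq)
  define d where "d = (LEAST d. d \<le> N \<and> c a b d \<noteq> 0)"
  have d: "d \<le> N" "c a b d \<noteq> 0"
    using LeastI_ex[of "\<lambda>d. d \<le> N \<and> c a b d \<noteq> 0"] b(2) unfolding d_def by blast+
  have "c a b d' = 0" if "d' < d" for d'
    using not_less_Least[OF that[unfolded d_def]] d(1) that by auto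
  then have "Const (c a b d) \<in> P 3"
    using lowest_coefficient_mem[OF P[of 2] P[of 3] _ z, of "\<lambda>d. Const (c a b d)" N d]
      chain'(3) 2 xyz d(1) by (simp add: closed Const_zero psubset_eq)
  then have "Const (1 / c a b d) * Const (c a b d) \<in> P 3"
    using ideal.I_l_closed[OF primeideal.axioms(1)[OF P[of 3]] _ mpoly_ring_closed(3)] by fastforce
  moreover have "Const (1 / c a b d) * Const (c a b d) = (1 :: 'k mpoly)"
    using d(2) by (simp add: Const_def mult_single)
  ultimately have "P 3 = carrier (mpoly_ring m)"
    using ideal.one_imp_carrier[OF primeideal.axioms(1)[OF P[of 3]]] by simp
  then show False using primeideal.I_notcarr[OF P[of 3]] by simp
qed

lemma krull_dim_le_2:
  "krull_dim (mpoly_ring m Quot (nonedge_ideal :: 'k::field mpoly set)) \<le> 2"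
  unfolding krull_dim_def
proof (rule Sup_least, safe)
  let ?I = "nonedge_ideal :: 'k mpoly set" and ?R = "mpoly_ring m :: 'k mpoly ring"
  let ?A = "?R Quot ?I"
  interpret I: ideal ?I ?R by (rule ideal_nonedge_ideal)
  interpret h: ring_hom_ring ?R ?A "(+>\<^bsub>?R\<^esub>) ?I" by (rule I.rcos_ring_hom_ring)
  fix l and P :: "nat \<Rightarrow> 'k mpoly set set"
  assume P: "\<forall>i\<le>l. primeideal (P i) ?A" "\<forall>i<l. P i \<subset> P (Suc i)"
  show "enat l \<le> 2"
  proof (rule ccontr)
    assume "\<not> enat l \<le> 2"
    then have l: "l \<ge> 3" by (simp add: numeral_eq_enat)
    define Q where "Q i = {p \<in> carrier ?R. ?I +>\<^bsub>?R\<^esub> p \<in> P i}" for i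
    have 1: "primeideal (Q i) ?R" if "i \<le> 3" for i
    proof -
      have "primeideal (P i) ?A" using P(1) l that by simp
      then show ?thesis unfolding Q_def by (rule h.primeideal_vimage[OF cring_mpoly_ring])
    qed
    have 2: "Q i \<subset> Q (Suc i)" if "i < 3" for i
    proof -
      have sub: "P i \<subset> P (Suc i)" using P(2) l that by simp
      from psubset_imp_ex_mem[OF sub] obtain Y where Y: "Y \<in> P (Suc i)" "Y \<notin> P i" by auto
      have "primeideal (P (Suc i)) ?A" using P(1) l that by simp
      then have "Y \<in> carrier ?A" using primeideal_subset Y(1) by blast
      then obtain p where p: "p \<in> carrier ?R" "a_r_coset ?R ?I p = Y"
        unfolding carrier_FactRing by blast
      have "Q i \<subseteq> Q (Suc i)" using psubset_imp_subset[OF sub] unfolding Q_def by blast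
      moreover have "p \<in> Q (Suc i)" "p \<notin> Q i" using p Y by (simp_all add: Q_def)
      ultimately show ?thesis by blast
    qed
    have zero: "\<zero>\<^bsub>?A\<^esub> \<in> P 0"
      by (rule primeideal_zero_mem) (use P(1) in simp)
    have "?I \<subseteq> Q 0"
    proof
      fix p assume p: "p \<in> ?I"
      then have "?I +>\<^bsub>?R\<^esub> p = ?I" by (rule I.a_rcos_zero[OF I.is_ideal])
      moreover have "\<zero>\<^bsub>?A\<^esub> = ?I" by (simp add: FactRing_def)
      ultimately show "p \<in> Q 0" using zero I.Icarr[OF p] by (simp add: Q_def)
    qed
    show False
      by (rule no_prime_chain_of_length_3[of Q]) (fact 1, fact 2, fact)
  qed
qed

end

section \<open>A regular sequence of length two\<close>

lemma lookup_Var_mult_edge: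
  fixes p :: "'k::comm_ring_1 mpoly"
  assumes "i \<noteq> j"
  shows "lookup (Var i * p) (single i a + single j b) = (if a = 0 then 0 else lookup p (single i (a - 1) + single j b))"
    and "lookup (Var j * p) (single i a + single j b) = (if b = 0 then 0 else lookup p (single i a + single j (b - 1)))"
proof -
  have *: "lookup (Var i * p) (single i a + single j b) = (if a = 0 then 0 else lookup p (single i (a - 1) + single j b))"
    if "i \<noteq> j" for i j a b
  proof -
    have "single i a + single j b - single i 1 = single i (a - 1) + single j b"
      by (rule poly_mapping_eqI) (use that in \<open>auto simp: lookup_add lookup_minus lookup_single when_def\<close>)
    moreover have "lookup (single i a + single j b) i = a"
      using that by (simp add: lookup_add lookup_single)
    ultimately show ?thesis unfolding lookup_Var_mult by metis
  qed
  show "lookup (Var i * p) (single i a + single j b) = (if a = 0 then 0 else lookup p (single i (a - 1) + single j b))"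
    and "lookup (Var j * p) (single i a + single j b) = (if b = 0 then 0 else lookup p (single i a + single j (b - 1)))"
    using *[OF assms, of a b] *[OF assms[symmetric], of b a] by (simp_all only: add.commute)
qed

text \<open>
  Multiplication of a monomial by the product of the variables in its support, i.e. every positive
  exponent grows by one. Unlike multiplication by a fixed monomial this preserves the support, and on
  monomials with both exponents on an edge \<open>{i, j}\<close> positive it is multiplication by \<open>x\<^sub>i x\<^sub>j\<close>.
\<close>

definition raise :: "(nat \<Rightarrow>\<^sub>0 nat) \<Rightarrow> nat \<Rightarrow>\<^sub>0 nat"
  where "raise t = Poly_Mapping.map Suc t"

lemma lookup_raise: "lookup (raise t) i = (if lookup t i = 0 then 0 else Suc (lookup t i))"
  by (simp add: raise_def map.rep_eq when_def)

lemma keys_raise: "keys (raise t) = keys t"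
  by (auto simp: in_keys_iff lookup_raise split: if_splits)

lemma inj_raise: "inj raise"
proof (rule injI)
  fix s t assume eq: "raise s = raise t"
  show "s = t"
  proof (rule poly_mapping_eqI)
    fix i show "lookup s i = lookup t i"
      using arg_cong[OF eq, of "\<lambda>t. lookup t i"] by (auto simp: lookup_raise split: if_splits)
  qed
qed

context connected_triangle_free_graph
begin

definition vertex_sum :: "'k::field mpoly"
  where "vertex_sum = (\<Sum>i\<in>{1..m}. Var i)"

definition edge_sum :: "'k::field mpoly"
  where "edge_sum = (\<Sum>e\<in>E. \<Prod>i\<in>e. Var i)"

lemma vertex_sum_closed: "vertex_sum \<in> carrier (mpoly_ring m)"
  unfolding vertex_sum_def by (intro mpoly_ring_sum_closed mpoly_ring_closed)

lemma edge_sum_closed: "edge_sum \<in> carrier (mpoly_ring m)"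
  unfolding edge_sum_def by (intro mpoly_ring_sum_closed mpoly_ring_prod_closed mpoly_ring_closed) (use edge in blast)

lemma lookup_vertex_sum_mult:
  fixes p :: "'k::field mpoly"
  assumes ij: "{i, j} \<in> E"
  shows "lookup (vertex_sum * p) (single i a + single j b) =
    (if a = 0 then 0 else lookup p (single i (a - 1) + single j b)) +
    (if b = 0 then 0 else lookup p (single i a + single j (b - 1)))"
proof -
  let ?t = "single i a + single j b"
  note ij' = edgeD[OF ij]
  have "lookup (vertex_sum * p) ?t = (\<Sum>l\<in>{1..m}. lookup (Var l * p) ?t)"
    by (simp add: vertex_sum_def sum_distrib_right lookup_sum)
  also have "\<dots> = (\<Sum>l\<in>{i, j}. lookup (Var l * p) ?t)"
    using ij' by (intro sum.mono_neutral_right) (auto simp: lookup_Var_mult lookup_add lookup_single when_def)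
  also have "\<dots> = lookup (Var i * p) ?t + lookup (Var j * p) ?t"
    using ij' by simp
  finally show ?thesis
    unfolding lookup_Var_mult_edge[OF ij'(1)] .
qed

text \<open>
  On the edge \<open>{i, j}\<close> the edge sum acts as \<open>x\<^sub>i x\<^sub>j\<close>, since every other edge contributes a variable that
  does not occur there.
\<close>

lemma lookup_edge_sum_mult:
  fixes p :: "'k::field mpoly"
  assumes ij: "{i, j} \<in> E"
  shows "lookup (edge_sum * p) (single i a + single j b) =
    (if a = 0 \<or> b = 0 then 0 else lookup p (single i (a - 1) + single j (b - 1)))"
proof -
  let ?t = "single i a + single j b"
  note ij' = edgeD[OF ij]
  have "lookup (edge_sum * p) ?t = (\<Sum>e\<in>E. lookup ((\<Prod>l\<in>e. Var l) * p) ?t)"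
    by (simp add: edge_sum_def sum_distrib_right lookup_sum)
  also have "\<dots> = (\<Sum>e\<in>{{i, j}}. lookup ((\<Prod>l\<in>e. Var l) * p) ?t)"
  proof (intro sum.mono_neutral_right ballI)
    fix e assume e: "e \<in> E - {{i, j}}"
    then obtain k l where kl: "e = {k, l}" "k \<noteq> l" using edge by (metis DiffD1 card_2_iff)
    have *: "lookup (Var k * (Var l * p)) ?t = 0" if "k \<notin> {i, j}" for k l
      using that by (simp add: lookup_Var_mult lookup_add lookup_single when_def)
    have "k \<notin> {i, j} \<or> l \<notin> {i, j}" using e kl by auto
    then show "lookup ((\<Prod>l\<in>e. Var l) * p) ?t = 0"
      using *[of k l] *[of l k] kl by (auto simp: mult_ac)
  qed (use ij finite_E in auto)
  also have "\<dots> = lookup (Var i * (Var j * p)) ?t"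
    using ij'(1) by (simp add: mult.assoc)
  finally show ?thesis
    unfolding lookup_Var_mult_edge[OF ij'(1)] by simp
qed

lemma edge_sum_nonzerodivisor:
  fixes p :: "'k::field mpoly"
  assumes p: "p \<in> carrier (mpoly_ring m)" and "edge_sum * p \<in> nonedge_ideal"
  shows "p \<in> nonedge_ideal"
  unfolding mem_nonedge_ideal_iff
proof (intro conjI allI impI p)
  fix i j a b assume "{i, j} \<in> E"
  then have "lookup (edge_sum * p) (single i (a + 1) + single j (b + 1)) = 0"
    using assms(2) mem_nonedge_ideal_iff by blast
  then show "lookup p (single i a + single j b) = 0"
    using lookup_edge_sum_mult[OF \<open>{i, j} \<in> E\<close>, of p "a + 1" "b + 1"] by simp
qed

text \<open>
  On an edge with variables \<open>x\<close>, \<open>y\<close> the hypothesis reads \<open>(x + y) f = x y g\<close>. Hence \<open>x y\<close> divides \<open>f\<close>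
  there, and the quotient must have the coefficients \<open>h(a, b) = f(a + 1, b + 1)\<close>. What has to be shown is
  that these prescriptions agree on monomials shared by several edges. For \<open>x\<^sub>i\<^sup>a\<close> with \<open>a > 0\<close>,
  comparing coefficients gives \<open>f(a + 1, 1) = g(a + 1, 0)\<close>, which mentions the vertex \<open>i\<close> only. For the
  constant monomial it gives the coefficient of \<open>g\<close> at \<open>x\<^sub>i\<close> and likewise that at \<open>x\<^sub>j\<close>; these
  agree along edges, hence everywhere by connectedness.
\<close>

lemma vertex_sum_nonzerodivisor_mod_edge_sum:
  fixes f g :: "'k::field mpoly"
  assumes f: "f \<in> carrier (mpoly_ring m)" and g: "g \<in> carrier (mpoly_ring m)"
    and fg: "vertex_sum * f - edge_sum * g \<in> nonedge_ideal"
  shows "\<exists>h \<in> carrier (mpoly_ring m). f - edge_sum * h \<in> nonedge_ideal"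
proof -
  have eq: "lookup (vertex_sum * f) (single i a + single j b) = lookup (edge_sum * g) (single i a + single j b)"
    if "{i, j} \<in> E" for i j a b
    using fg that unfolding mem_nonedge_ideal_iff by (simp add: lookup_minus)
  have f0: "lookup f (single i a) = 0" if "{i, j} \<in> E" for i j a
    using eq[OF that, of "a + 1" 0]
    unfolding lookup_vertex_sum_mult[OF that] lookup_edge_sum_mult[OF that] by simp
  have f1: "lookup f (single i a + single j 1) = lookup g (single i a)" if "{i, j} \<in> E" for i j a
    using eq[OF that, of "a + 1" 1] f0[OF that, of "a + 1"]
    by (simp add: lookup_vertex_sum_mult[OF that] lookup_edge_sum_mult[OF that])
  have g_edge: "lookup g (single i 1) = lookup g (single j 1)" if "{i, j} \<in> E" for i j
    using f1[OF that, of 1] f1[of j i 1] that by (simp add: insert_commute add.commute)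
  have g_path: "lookup g (single i 1) = lookup g (single j 1)" if "(i, j) \<in> {(a, b). {a, b} \<in> E}\<^sup>*" for i j
    using that by (induction rule: rtrancl_induct) (auto dest: g_edge)
  \<comment> \<open>The value at the constant monomial may be taken from any vertex \<open>v\<close>.\<close>
  obtain v w where vw: "{v, w} \<in> E" using nonempty edge by (metis card_2_iff equals0I)
  define H where "H t = (if t = 0 then lookup g (single v 1)
    else if card (keys t) = 1 then lookup g (raise t) else lookup f (raise t))" for t
  have H_keys: "t = 0 \<or> raise t \<in> keys f \<union> keys g" if "H t \<noteq> 0" for t
    using that by (auto simp: H_def in_keys_iff split: if_splits)
  have "finite (raise -` (keys f \<union> keys g))"
    by (rule finite_vimageI[OF _ inj_raise]) simp
  moreover have "{t. H t \<noteq> 0} \<subseteq> insert 0 (raise -` (keys f \<union> keys g))"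
    using H_keys by auto
  ultimately have fin: "finite {t. H t \<noteq> 0}"
    by (meson finite_insert finite_subset)
  define h where "h = Abs_poly_mapping H"
  have h: "lookup h t = H t" for t
    using fin by (simp add: h_def)
  have h_closed: "h \<in> carrier (mpoly_ring m)"
    unfolding carrier_mpoly_ring_iff
  proof
    fix t assume "t \<in> keys h"
    then have "t = 0 \<or> raise t \<in> keys f \<union> keys g" using H_keys by (simp add: in_keys_iff h)
    then show "keys t \<subseteq> {1..m}"
      using f g keys_raise[of t] by (auto simp: carrier_mpoly_ring_iff)
  qed
  have raise_edge: "raise (single i a + single j b) =
      single i (if a = 0 then 0 else a + 1) + single j (if b = 0 then 0 else b + 1)" if "i \<noteq> j" for i j a b
    by (rule poly_mapping_eqI) (use that in \<open>auto simp: lookup_raise lookup_add lookup_single when_def\<close>)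
  have keys_edge: "keys (single i a + single j b) = {i, j}" if "i \<noteq> j" "a \<noteq> 0" "b \<noteq> 0" for i j a b :: nat
  proof (rule Set.set_eqI)
    show "l \<in> keys (single i a + single j b) \<longleftrightarrow> l \<in> {i, j}" for l
      using that by (cases "l = i"; cases "l = j") (simp_all add: in_keys_iff lookup_add lookup_single)
  qed
  have h_vertex: "lookup h (single i a) = lookup f (single i (a + 1) + single j 1)" if ij: "{i, j} \<in> E" for i j a
  proof (cases "a = 0")
    case True
    have "lookup g (single v 1) = lookup g (single i 1)"
      using g_path connected edgeD[OF vw] edgeD[OF ij] by metis
    then show ?thesis using True f1[OF ij, of 1] by (simp add: h H_def)
  next
    case False
    then have "single i a \<noteq> 0" by (metis lookup_single_eq lookup_zero)
    moreover have "raise (single i a) = single i (a + 1)"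
      using raise_edge[OF edgeD(1)[OF ij], of a 0] False by simp
    ultimately show ?thesis using False f1[OF ij, of "a + 1"] by (simp add: h H_def)
  qed
  have h_edge: "lookup h (single i a + single j b) = lookup f (single i (a + 1) + single j (b + 1))"
    if ij: "{i, j} \<in> E" for i j a b
  proof -
    consider "b = 0" | "a = 0" | "a \<noteq> 0" "b \<noteq> 0" by blast
    then show ?thesis
    proof cases
      case 1
      then show ?thesis using h_vertex[OF ij] by simp
    next
      case 2
      then show ?thesis using h_vertex[of j i b] ij by (simp add: insert_commute add.commute)
    next
      case 3
      then have "card (keys (single i a + single j b)) = 2"
        using edgeD(1)[OF ij] by (simp add: keys_edge)
      moreover from this have "single i a + single j b \<noteq> 0" by auto
      ultimately show ?thesis
        using raise_edge[OF edgeD(1)[OF ij], of a b] 3 by (simp add: h H_def)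
    qed
  qed
  have "lookup f (single i a + single j b) = lookup (edge_sum * h) (single i a + single j b)"
    if ij: "{i, j} \<in> E" for i j a b
  proof -
    consider "b = 0" | "a = 0" | a' b' where "a = a' + 1" "b = b' + 1"
      by (metis Suc_eq_plus1 not0_implies_Suc)
    then show ?thesis
    proof cases
      case 1
      then show ?thesis using f0[OF ij] by (simp add: lookup_edge_sum_mult[OF ij, of h a 0, simplified])
    next
      case 2
      have "{j, i} \<in> E" using ij by (simp add: insert_commute)
      then show ?thesis using 2 f0[of j i b] by (simp add: lookup_edge_sum_mult[OF ij, of h 0 b, simplified])
    next
      case 3
      then show ?thesis using h_edge[OF ij, of a' b'] by (simp add: lookup_edge_sum_mult[OF ij])
    qed
  qed
  then have "f - edge_sum * h \<in> nonedge_ideal"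
    unfolding mem_nonedge_ideal_iff
    using mpoly_ring_minus_closed[OF f mpoly_ring_closed(7)[OF edge_sum_closed h_closed]]
    by (simp add: lookup_minus)
  then show ?thesis using h_closed by blast
qed

end

section \<open>Cohen--Macaulayness for connected triangle-free graphs\<close>

lemma ideal_zero_constant_term:
  "ideal {p \<in> carrier (mpoly_ring m). lookup p 0 = 0} (mpoly_ring m :: 'k::comm_ring_1 mpoly ring)"
proof (rule mpoly_idealI, goal_cases)
  case (4 r p)
  have "0 \<notin> keys (r * p)"
  proof
    assume "0 \<in> keys (r * p)"
    then have "0 \<in> {u + v | u v. u \<in> keys r \<and> v \<in> keys p}" using keys_mult[of r p] by (rule rev_subsetD)
    then obtain u v where uv: "0 = u + v" "v \<in> keys p" by blast
    have "v = 0"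
    proof (rule poly_mapping_eqI)
      show "lookup v i = lookup 0 i" for i
        using arg_cong[OF uv(1), of "\<lambda>t. lookup t i"] by (simp add: lookup_add)
    qed
    then show False using uv(2) 4 by (simp add: in_keys_iff)
  qed
  then show ?case using 4 by (simp add: in_keys_iff mpoly_ring_closed)
qed (auto simp: mpoly_ring_closed lookup_add)

context connected_triangle_free_graph
begin

text \<open>
  The two sums form a regular sequence in the quotient, and the ideal they generate is proper because
  its elements have no constant term.
\<close>

lemma cohen_macaulay_nonedge_ideal: "cohen_macaulay m (nonedge_ideal :: 'k::field mpoly set)"
proof -
  let ?I = "nonedge_ideal :: 'k mpoly set" and ?R = "mpoly_ring m :: 'k mpoly ring"
  let ?A = "?R Quot ?I" and ?\<phi> = "a_r_coset ?R ?I"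
  let ?v = "vertex_sum :: 'k mpoly" and ?e = "edge_sum :: 'k mpoly"
  interpret R: cring ?R by (rule cring_mpoly_ring)
  interpret I: ideal ?I ?R by (rule ideal_nonedge_ideal)
  interpret A: cring ?A by (rule I.quotient_is_cring[OF cring_mpoly_ring])
  interpret \<phi>: ring_hom_ring ?R ?A ?\<phi> by (rule I.rcos_ring_hom_ring)
  have \<phi>_eq: "?\<phi> p = ?\<phi> q \<longleftrightarrow> p - q \<in> ?I" if "p \<in> carrier ?R" "q \<in> carrier ?R" for p q
    using R.quotient_eq_iff_same_a_r_cos[OF ideal_nonedge_ideal that] mpoly_ring_a_minus[OF that(2)] by simp
  have \<phi>_mult: "?\<phi> p \<otimes>\<^bsub>?A\<^esub> ?\<phi> q = ?\<phi> (p * q)" if "p \<in> carrier ?R" "q \<in> carrier ?R" for p q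
    using \<phi>.hom_mult[OF that] by simp
  have \<phi>_zero: "?\<phi> 0 = \<zero>\<^bsub>?A\<^esub>" using \<phi>.hom_zero by simp
  note e = edge_sum_closed[where ?'a = 'k] and v = vertex_sum_closed[where ?'a = 'k]
  have z: "0 \<in> carrier ?R" by (rule mpoly_ring_closed)
  have \<phi>e: "?\<phi> ?e \<in> carrier ?A" and \<phi>v: "?\<phi> ?v \<in> carrier ?A"
    using \<phi>.hom_closed e v by blast+
  let ?xs = "[?\<phi> ?e, ?\<phi> ?v]"
  have reg0: "a \<in> Idl\<^bsub>?A\<^esub> {}" if a: "a \<in> carrier ?A" "?\<phi> ?e \<otimes>\<^bsub>?A\<^esub> a \<in> Idl\<^bsub>?A\<^esub> {}" for a
  proof -
    have "Idl\<^bsub>?A\<^esub> {} \<subseteq> {\<zero>\<^bsub>?A\<^esub>}" by (rule A.genideal_minimal[OF A.zeroideal]) simp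
    then have zero: "?\<phi> ?e \<otimes>\<^bsub>?A\<^esub> a = \<zero>\<^bsub>?A\<^esub>" using a(2) by blast
    obtain p where p: "p \<in> carrier ?R" "a = ?\<phi> p" using a(1) unfolding carrier_FactRing by blast
    have "?\<phi> (?e * p) = ?\<phi> 0" using zero \<phi>_mult[OF e p(1)] \<phi>_zero p(2) by simp
    then have "?e * p \<in> ?I" using \<phi>_eq[of "?e * p" 0] mpoly_ring_closed(7)[OF e p(1)] z by simp
    then have "p \<in> ?I" by (rule edge_sum_nonzerodivisor[OF p(1)])
    then have "a = \<zero>\<^bsub>?A\<^esub>" using \<phi>_eq[of p 0] p z \<phi>_zero by simp
    then show ?thesis
      using additive_subgroup.zero_closed[OF ideal.axioms(1)[OF A.genideal_ideal[of "{}"]]] by simp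
  qed
  have reg1: "a \<in> Idl\<^bsub>?A\<^esub> {?\<phi> ?e}" if a: "a \<in> carrier ?A" "?\<phi> ?v \<otimes>\<^bsub>?A\<^esub> a \<in> Idl\<^bsub>?A\<^esub> {?\<phi> ?e}" for a
  proof -
    obtain p where p: "p \<in> carrier ?R" "a = ?\<phi> p" using a(1) unfolding carrier_FactRing by blast
    obtain c where c: "c \<in> carrier ?A" "?\<phi> ?v \<otimes>\<^bsub>?A\<^esub> a = c \<otimes>\<^bsub>?A\<^esub> ?\<phi> ?e"
      using a(2) unfolding A.cgenideal_eq_genideal[OF \<phi>e, symmetric] cgenideal_def by blast
    obtain q where q: "q \<in> carrier ?R" "c = ?\<phi> q" using c(1) unfolding carrier_FactRing by blast
    have "?\<phi> (?v * p) = ?\<phi> (?e * q)"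
      using c(2) \<phi>_mult[OF v p(1)] \<phi>_mult[OF q(1) e] p(2) q(2) by (simp add: mult.commute)
    then have "?v * p - ?e * q \<in> ?I"
      using \<phi>_eq mpoly_ring_closed(7)[OF v p(1)] mpoly_ring_closed(7)[OF e q(1)] by blast
    then obtain h where h: "h \<in> carrier ?R" "p - ?e * h \<in> ?I"
      using vertex_sum_nonzerodivisor_mod_edge_sum[OF p(1) q(1)] by blast
    have "a = ?\<phi> (h * ?e)"
      using \<phi>_eq[OF p(1) mpoly_ring_closed(7)[OF h(1) e]] h(2) p(2) by (simp add: mult.commute)
    then have "a = ?\<phi> h \<otimes>\<^bsub>?A\<^esub> ?\<phi> ?e" using \<phi>_mult[OF h(1) e] by simp
    then show ?thesis
      unfolding A.cgenideal_eq_genideal[OF \<phi>e, symmetric] cgenideal_def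
      using \<phi>.hom_closed[OF h(1)] by blast
  qed
  let ?M = "{p \<in> carrier ?R. lookup p 0 = 0}"
  have vars: "Var ` {1..m} \<subseteq> carrier ?R" by (auto intro: mpoly_ring_closed)
  have irr: "ideal (irrelevant_ideal m) ?R"
    unfolding irrelevant_ideal_def by (rule R.genideal_ideal[OF vars])
  have irr_Var: "Var i \<in> (irrelevant_ideal m :: 'k mpoly set)" if "i \<in> {1..m}" for i
    unfolding irrelevant_ideal_def using R.genideal_self[OF vars] that by blast
  have v_irr: "?v \<in> irrelevant_ideal m"
    unfolding vertex_sum_def by (rule mpoly_ideal_sum[OF irr irr_Var])
  have e_irr: "?e \<in> irrelevant_ideal m"
    unfolding edge_sum_def
  proof (rule mpoly_ideal_sum[OF irr])
    fix d assume d: "d \<in> E"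
    then obtain k l where kl: "d = {k, l}" "k \<noteq> l" using edge by (metis card_2_iff)
    have "Var k * Var l \<in> (irrelevant_ideal m :: 'k mpoly set)"
      using ideal.I_r_closed[OF irr irr_Var mpoly_ring_closed(4)] edgeD[of k l] d kl by simp
    then show "(\<Prod>i\<in>d. Var i) \<in> (irrelevant_ideal m :: 'k mpoly set)" using kl by simp
  qed
  have irr_M: "irrelevant_ideal m \<subseteq> ?M"
    unfolding irrelevant_ideal_def
  proof (rule R.genideal_minimal[OF ideal_zero_constant_term], safe)
    fix i assume "i \<in> {1..m}"
    then show "Var i \<in> carrier ?R" by (rule mpoly_ring_closed)
    have "single i (1::nat) \<noteq> 0" by (metis lookup_single_eq lookup_zero one_neq_zero)
    then show "lookup (Var i :: 'k mpoly) 0 = 0" by (simp add: Var_def lookup_single when_def)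
  qed
  have proper: "Idl\<^bsub>?A\<^esub> (set ?xs) \<noteq> carrier ?A"
  proof
    assume eq: "Idl\<^bsub>?A\<^esub> (set ?xs) = carrier ?A"
    have "Idl\<^bsub>?A\<^esub> (set ?xs) \<subseteq> ?\<phi> ` ?M"
      using v_irr e_irr irr_M
      by (intro A.genideal_minimal R.ring_ideal_imp_quot_ideal ideal_nonedge_ideal ideal_zero_constant_term) auto
    then have "?\<phi> 1 \<in> ?\<phi> ` ?M"
      using eq \<phi>.hom_closed[OF mpoly_ring_closed(2)] by blast
    then obtain p where p: "p \<in> carrier ?R" "lookup p 0 = 0" "?\<phi> 1 = ?\<phi> p" by blast
    then have "1 - p \<in> ?I" using \<phi>_eq[OF mpoly_ring_closed(2)] by simp
    moreover obtain i j where "{i, j} \<in> E" using nonempty edge by (metis card_2_iff equals0I)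
    ultimately have "lookup (1 - p) (single i 0 + single j 0) = 0"
      unfolding mem_nonedge_ideal_iff by blast
    then show False using p(2) by (simp add: lookup_minus)
  qed
  have "regular_sequence ?A ?xs"
    unfolding regular_sequence_def
  proof (intro conjI proper allI impI ballI)
    show "set ?xs \<subseteq> carrier ?A" using \<phi>e \<phi>v by simp
    fix i a assume "i < length ?xs" and a: "a \<in> carrier ?A"
      "?xs ! i \<otimes>\<^bsub>?A\<^esub> a \<in> Idl\<^bsub>?A\<^esub> (set (take i ?xs))"
    then consider "i = 0" | "i = 1" by force
    then show "a \<in> Idl\<^bsub>?A\<^esub> (set (take i ?xs))"
      using reg0[OF a(1)] reg1[OF a(1)] a(2) by cases simp_all
  qed
  then have "enat (length ?xs) \<le> depth ?A (?\<phi> ` irrelevant_ideal m)"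
    unfolding depth_def using v_irr e_irr by (intro Sup_upper CollectI exI[of _ ?xs]) simp
  moreover have "depth ?A (?\<phi> ` irrelevant_ideal m) \<le> krull_dim ?A"
    by (rule A.depth_le_krull_dim)
  moreover have "krull_dim ?A \<le> enat (length ?xs)"
    using krull_dim_le_2 by (simp add: numeral_eq_enat eval_nat_numeral)
  ultimately show ?thesis
    unfolding cohen_macaulay_def by (meson order_antisym order_trans)
qed

end

section \<open>Complements of cycles and increasing maps\<close>

lemma cycle_edge_iff:
  assumes "n \<ge> 3"
  shows "{i, j} \<in> cycle_edges n \<longleftrightarrow>
    (1 \<le> i \<and> j = i + 1 \<and> j \<le> n) \<or> (1 \<le> j \<and> i = j + 1 \<and> i \<le> n) \<or> (i = 1 \<and> j = n) \<or> (i = n \<and> j = 1)"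
proof -
  have "{i, j} \<in> cycle_edges n \<longleftrightarrow>
      (\<exists>l. 1 \<le> l \<and> l \<le> n - 1 \<and> {i, j} = {l, l + 1}) \<or> {i, j} = {1, n}"
    unfolding cycle_edges_def by blast
  then show ?thesis using assms unfolding doubleton_eq_iff by auto
qed

lemma cycle_connected_triangle_free:
  assumes n: "n \<ge> 4"
  shows "connected_triangle_free_graph n (cycle_edges n)"
proof
  fix e assume "e \<in> cycle_edges n"
  then show "e \<subseteq> {1..n} \<and> card e = 2"
    using n unfolding cycle_edges_def by auto
next
  show "cycle_edges n \<noteq> {}" by (auto simp: cycle_edges_def)
next
  have iff: "{i, j} \<in> cycle_edges n \<longleftrightarrow>
    (1 \<le> i \<and> j = i + 1 \<and> j \<le> n) \<or> (1 \<le> j \<and> i = j + 1 \<and> i \<le> n) \<or> (i = 1 \<and> j = n) \<or> (i = n \<and> j = 1)" for i j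
    using n by (intro cycle_edge_iff) simp
  fix i j k assume ij: "{i, j} \<in> cycle_edges n" and jk: "{j, k} \<in> cycle_edges n"
  show "{i, k} \<notin> cycle_edges n"
  proof
    assume "{i, k} \<in> cycle_edges n"
    with ij jk show False
      using n unfolding iff by (elim disjE conjE; linarith)
  qed
next
  let ?r = "{(a, b). {a, b} \<in> cycle_edges n}"
  have step: "{i, i + 1} \<in> cycle_edges n" if "1 \<le> i" "i + 1 \<le> n" for i
    using cycle_edge_iff[of n i "i + 1"] n that by simp
  have from_1: "(1, i) \<in> ?r\<^sup>*" if "1 \<le> i" "i \<le> n" for i
    using that
  proof (induction i rule: nat_induct_at_least)
    case (Suc i)
    then show ?case using step[of i] by (auto intro: rtrancl_into_rtrancl)
  qed simp
  have "sym ?r" by (auto simp: sym_def insert_commute)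
  then have sym: "sym (?r\<^sup>*)" by (rule sym_rtrancl)
  fix i j assume "i \<in> {1..n}" "j \<in> {1..n}"
  then show "(i, j) \<in> ?r\<^sup>*"
    using from_1[of i] from_1[of j] symD[OF sym] by (auto intro: rtrancl_trans)
qed

lemma Inc_gap:
  assumes \<pi>: "\<pi> \<in> Inc n m" and ij: "1 \<le> i" "i \<le> j" "j \<le> n"
  shows "\<pi> i + (j - i) \<le> \<pi> j"
  using ij(2,3)
proof (induction j rule: dec_induct)
  case (step j)
  have "\<pi> j < \<pi> (Suc j)"
    using \<pi> step ij(1) by (intro strict_mono_onD[of "{1..n}" \<pi>]) (auto simp: Inc_def)
  then show ?case using step by simp
qed simp

lemma Inc_range: "\<pi> \<in> Inc n m \<Longrightarrow> i \<in> {1..n} \<Longrightarrow> \<pi> i \<in> {1..m}"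
  unfolding Inc_def by blast

lemma edge_ideal_gens:
  fixes E :: "nat set set"
  assumes "\<And>e. e \<in> E \<Longrightarrow> e \<subseteq> {1..m}"
  shows "{Var i * Var j | i j. {i, j} \<in> E} \<subseteq> carrier (mpoly_ring m :: 'k::comm_ring_1 mpoly ring)"
proof safe
  fix i j assume "{i, j} \<in> E"
  then have "{i, j} \<subseteq> {1..m}" by (rule assms)
  then show "Var i * Var j \<in> carrier (mpoly_ring m :: 'k mpoly ring)"
    by (intro mpoly_ring_closed) auto
qed

text \<open>
  Increasing maps do not shrink gaps, which bounds \<open>\<pi> j - \<pi> i\<close> from below. Applied to the gaps before \<open>i\<close>
  and after \<open>j\<close>, the same fact leaves room for at most \<open>n + r - 2\<close> between \<open>\<pi> i\<close> and \<open>\<pi> j\<close>.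
\<close>

lemma Inc_complement_cycle_edge:
  assumes n: "n \<ge> 4" and \<pi>: "\<pi> \<in> Inc n (n + r)" and ij: "{i, j} \<in> complement_edges n (cycle_edges n)"
  shows "{\<pi> i, \<pi> j} \<in> complement_edges (n + r) (cycle_edges (n + r))"
proof -
  have *: "{\<pi> i, \<pi> j} \<in> complement_edges (n + r) (cycle_edges (n + r))"
    if ij: "{i, j} \<in> complement_edges n (cycle_edges n)" and "i < j" for i j
  proof -
    have b: "1 \<le> i" "j \<le> n" using ij by (auto simp: complement_edges_def)
    then have gap: "2 \<le> j - i" "j - i \<le> n - 2"
      using complement_cycle_edges_iff[of n i j] n ij \<open>i < j\<close> by auto
    have "\<pi> 1 + (i - 1) \<le> \<pi> i" "\<pi> i + (j - i) \<le> \<pi> j" "\<pi> j + (n - j) \<le> \<pi> n"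
      using Inc_gap[OF \<pi>] b \<open>i < j\<close> by auto
    moreover have "\<pi> 1 \<ge> 1" "\<pi> n \<le> n + r"
      using Inc_range[OF \<pi>, of 1] Inc_range[OF \<pi>, of n] n by auto
    ultimately show ?thesis
      using gap b n \<open>i < j\<close> by (subst complement_cycle_edges_iff) linarith+
  qed
  have "i \<noteq> j" using ij by (auto simp: complement_edges_def)
  then show ?thesis using *[of i j] *[of j i] ij by (cases "i < j") (auto simp: insert_commute)
qed

text \<open>
  The map \<open>\<pi>\<close> is a shift by \<open>a - i\<close> below \<open>j\<close> and by \<open>b - j\<close> from \<open>j\<close> on. The gap \<open>d = j - i\<close> is chosen
  as large as the edges of \<open>C\<^sub>n\<^sup>c\<close> and the target \<open>b - a\<close> permit, and \<open>i\<close> as large as possible for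
  that gap, so that both shifts stay at most \<open>r\<close>.
\<close>

lemma complement_cycle_edge_lift:
  assumes n: "n \<ge> 4" and ab: "{a, b} \<in> complement_edges (n + r) (cycle_edges (n + r))" "a < b"
  obtains \<pi> i j where "\<pi> \<in> Inc n (n + r)" "{i, j} \<in> complement_edges n (cycle_edges n)" "\<pi> i = a" "\<pi> j = b"
proof -
  have range: "1 \<le> a" "b \<le> n + r" using ab by (auto simp: complement_edges_def)
  then have gap: "2 \<le> b - a" "b - a \<le> n + r - 2"
    using complement_cycle_edges_iff[of "n + r" a b] n ab by auto
  define d where "d = min (n - 2) (b - a)"
  define i where "i = min a (n - d)"
  define j where "j = i + d"
  define \<pi> where "\<pi> = (\<lambda>l\<in>{1..n}. l + (if l < j then a - i else b - j))"
  have d: "2 \<le> d" "d \<le> n - 2" "d \<le> b - a" "d = n - 2 \<or> d = b - a"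
    using gap n by (cases "n - 2 \<le> b - a"; simp add: d_def)+
  have i: "1 \<le> i" "i \<le> a" "i \<le> n - d" "i = a \<or> i = n - d"
    using range d(2) n by (cases "a \<le> n - d"; simp add: i_def)+
  have i': "i + d \<le> n" using i d n by linarith
  have br: "b \<le> j + r"
    using gap range n d(4) i(4) i' ab(2) unfolding j_def by linarith
  have le: "a - i \<le> b - j" "j \<le> b" using d i ab(2) unfolding j_def by linarith+
  show thesis
  proof
    show "\<pi> \<in> Inc n (n + r)"
      unfolding Inc_def
    proof (safe intro!: PiE_I strict_mono_onI)
      fix l assume l: "l \<in> {1..n}"
      have "a - i \<le> r" "b - j \<le> r" using br le(1) by linarith+
      then have "(if l < j then a - i else b - j) \<le> r" by simp
      then show "\<pi> l \<in> {1..n + r}" using l by (simp add: \<pi>_def)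
    next
      fix k l assume "k \<in> {1..n}" "l \<in> {1..n}" "k < l"
      then show "\<pi> k < \<pi> l"
        using le(1) by (cases "k < j"; cases "l < j") (simp_all add: \<pi>_def)
    qed (auto simp: \<pi>_def)
    show "{i, j} \<in> complement_edges n (cycle_edges n)"
      using i i' d n by (subst complement_cycle_edges_iff) (simp_all add: j_def)
    show "\<pi> i = a" "\<pi> j = b" using i i' d le by (simp_all add: \<pi>_def j_def)
  qed
qed

lemma Inc_ideal_complement_cycle:
  assumes n: "n \<ge> 4"
  shows "Inc_ideal n (n + r) (edge_ideal n (complement_edges n (cycle_edges n))) =
    (edge_ideal (n + r) (complement_edges (n + r) (cycle_edges (n + r))) :: 'k::comm_ring_1 mpoly set)"
proof (rule subset_antisym)
  let ?En = "complement_edges n (cycle_edges n)" and ?Em = "complement_edges (n + r) (cycle_edges (n + r))"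
  let ?In = "edge_ideal n ?En :: 'k mpoly set" and ?Im = "edge_ideal (n + r) ?Em :: 'k mpoly set"
  let ?Rn = "mpoly_ring n :: 'k mpoly ring" and ?Rm = "mpoly_ring (n + r) :: 'k mpoly ring"
  interpret Rn: cring ?Rn by (rule cring_mpoly_ring)
  interpret Rm: cring ?Rm by (rule cring_mpoly_ring)
  have gens_n: "{Var i * Var j | i j. {i, j} \<in> ?En} \<subseteq> carrier ?Rn"
    and gens_m: "{Var i * Var j | i j. {i, j} \<in> ?Em} \<subseteq> carrier ?Rm"
    by (intro edge_ideal_gens; simp add: complement_edges_def)+
  have In: "ideal ?In ?Rn" and Im: "ideal ?Im ?Rm"
    unfolding edge_ideal_def by (rule Rn.genideal_ideal[OF gens_n], rule Rm.genideal_ideal[OF gens_m])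
  have memn: "Var i * Var j \<in> ?In" if "{i, j} \<in> ?En" for i j
    using Rn.genideal_self[OF gens_n] that unfolding edge_ideal_def by blast
  have memm: "Var i * Var j \<in> ?Im" if "{i, j} \<in> ?Em" for i j
    using Rm.genideal_self[OF gens_m] that unfolding edge_ideal_def by blast
  have image: "subst_vars \<pi> ` ?In \<subseteq> ?Im" if \<pi>: "\<pi> \<in> Inc n (n + r)" for \<pi>
  proof -
    interpret \<pi>: ring_hom_ring ?Rn ?Rm "subst_vars \<pi>"
      by (rule ring_hom_ringI2[OF Rn.ring_axioms Rm.ring_axioms subst_vars_ring_hom[OF \<pi>]])
    have "?In \<subseteq> {p \<in> carrier ?Rn. subst_vars \<pi> p \<in> ?Im}"
      unfolding edge_ideal_def[of n]
    proof (rule Rn.genideal_minimal[OF \<pi>.ideal_vimage[OF Im]], safe)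
      fix i j assume ij: "{i, j} \<in> ?En"
      then show "Var i * Var j \<in> carrier ?Rn" using gens_n by blast
      show "subst_vars \<pi> (Var i * Var j) \<in> ?Im"
        unfolding subst_vars_mult subst_vars_Var by (rule memm[OF Inc_complement_cycle_edge[OF n \<pi> ij]])
    qed
    then show ?thesis by blast
  qed
  then have union: "(\<Union>\<pi>\<in>Inc n (n + r). subst_vars \<pi> ` ?In) \<subseteq> ?Im" by blast
  show "Inc_ideal n (n + r) ?In \<subseteq> ?Im"
    unfolding Inc_ideal_def by (rule Rm.genideal_minimal[OF Im union])
  have union_carrier: "(\<Union>\<pi>\<in>Inc n (n + r). subst_vars \<pi> ` ?In) \<subseteq> carrier ?Rm"
    using union additive_subgroup.a_subset[OF ideal.axioms(1)[OF Im]] by (rule subset_trans)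
  have lift: "Var a * Var b \<in> Inc_ideal n (n + r) ?In" if ab: "{a, b} \<in> ?Em" "a < b" for a b
  proof -
    obtain \<pi> i j where "\<pi> \<in> Inc n (n + r)" "{i, j} \<in> ?En" "\<pi> i = a" "\<pi> j = b"
      using complement_cycle_edge_lift[OF n ab] by metis
    then have "subst_vars \<pi> (Var i * Var j) \<in> (\<Union>\<pi>\<in>Inc n (n + r). subst_vars \<pi> ` ?In)"
      "subst_vars \<pi> (Var i * Var j) = (Var a * Var b :: 'k mpoly)"
      using memn[of i j] by (blast, simp add: subst_vars_mult subst_vars_Var)
    then show ?thesis
      unfolding Inc_ideal_def using Rm.genideal_self[OF union_carrier] by auto
  qed
  show "?Im \<subseteq> Inc_ideal n (n + r) ?In"
    unfolding edge_ideal_def[of "n + r"]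
  proof (rule Rm.genideal_minimal, goal_cases)
    case 1
    show ?case unfolding Inc_ideal_def by (rule Rm.genideal_ideal[OF union_carrier])
  next
    case 2
    show ?case
    proof safe
      fix a b assume ab: "{a, b} \<in> ?Em"
      then have "a \<noteq> b" by (auto simp: complement_edges_def)
      then show "Var a * Var b \<in> Inc_ideal n (n + r) ?In"
        using lift[of a b] lift[of b a] ab by (cases "a < b") (simp_all add: insert_commute mult.commute)
    qed
  qed
qed

theorem theorem3p19:
  fixes n r :: nat
  assumes "n \<ge> 4"
  shows "cohen_macaulay (n + r)
    (Inc_ideal n (n + r) (edge_ideal n (complement_edges n (cycle_edges n))) :: 'k::field mpoly set)"
proof -
  interpret connected_triangle_free_graph "n + r" "cycle_edges (n + r)"
    by (rule cycle_connected_triangle_free) (use assms in simp)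
  show ?thesis
    unfolding Inc_ideal_complement_cycle[OF assms]
    using cohen_macaulay_nonedge_ideal by (simp only: nonedge_ideal_def)
qed

end
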